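(* Let $\Gamma$ be a finitely generated abelian group and $\mathcal{A}$ a finite list of elements of $\Gamma$. Then $$\chi_{\mathcal{A}(\mathbb{R})}(t)=f^1_{\mathcal{A}\smallsetminus\mathcal{A}^{\mathrm{tor}}}(t).$$
   Context: $\Gamma_{\mathrm{tor}}$ is the torsion subgroup of $\Gamma$ and $\mathcal{A}^{\mathrm{tor}}:=\mathcal{A}\cap\Gamma_{\mathrm{tor}}$; $\mathcal{A}\smallsetminus\mathcal{A}^{\mathrm{tor}}$ is regarded as a list in $\Gamma$. $\mathcal{A}(\mathbb{R})$ is the multiset of subspaces $H_{\alpha,\mathbb{R}}=\{\varphi\in\operatorname{Hom}(\Gamma,\mathbb{R})\mid\varphi(\alpha)=0\}$, $\alpha\in\mathcal{A}$, of the real vector space $V=\operatorname{Hom}(\Gamma,\mathbb{R})\cong\mathbb{R}^{r_\Gamma}$ (for torsion $\alpha$, $H_{\alpha,\mathbb{R}}=V$). Its characteristic polynomial is $\chi_{\mathcal{A}(\mathbb{R})}(t)=\sum_{Y\in L}\mu(V,Y)\,t^{\dim Y}$, where $L$ is the set of all intersections of subfamilies of $\mathcal{A}(\mathbb{R})$ (including $V$), ordered by reverse inclusion, and $\mu$ is its Möbius function. For a finite list $\mathcal{B}$ in $\Gamma$: for each sublist $\mathcal{S}\subseteq\mathcal{B}$ write $\Gamma/\langle\mathcal{S}\rangle\simeq\bigoplus_{i=1}^{n_{\mathcal{S}}}\mathbb{Z}/d_{\mathcal{S},i}\mathbb{Z}\oplus\mathbb{Z}^{m}$ with $1<d_{\mathcal{S},i}\mid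 d_{\mathcal{S},i+1}$ (and $d_{\mathcal{S},n_{\mathcal{S}}}:=1$ if $n_{\mathcal{S}}=0$); the LCM-period is $\rho_{\mathcal{B}}:=\operatorname{lcm}(d_{\mathcal{S},n_{\mathcal{S}}}\mid\mathcal{S}\subseteq\mathcal{B})$. The chromatic quasi-polynomial $\chi^{\mathrm{quasi}}_{\mathcal{B}}(q):=\#\{\varphi\in\operatorname{Hom}(\Gamma,\mathbb{Z}/q\mathbb{Z})\mid\varphi(\beta)\ne\overline0\ \forall\beta\in\mathcal{B}\}$ is known to be a quasi-polynomial with period $\rho_{\mathcal{B}}$; $f^1_{\mathcal{B}}(t)\in\mathbb{Z}[t]$ denotes its $1$-constituent, the polynomial with $\chi^{\mathrm{quasi}}_{\mathcal{B}}(q)=f^1_{\mathcal{B}}(q)$ for all $q\in\mathbb{Z}_{>0}$ with $q\equiv1\bmod\rho_{\mathcal{B}}$. *)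

theory Defs
  imports
    "HOL-Algebra.Product_Groups"
    "HOL-Computational_Algebra.Polynomial"
    "HOL-Library.Function_Algebras"
    "HOL-Library.Multiset"
    "HOL-Number_Theory.Cong"
begin

definition finitely_generated :: "('a, 'm) monoid_scheme \<Rightarrow> bool" where
  "finitely_generated G \<longleftrightarrow> (\<exists>S. finite S \<and> S \<subseteq> carrier G \<and> generate G S = carrier G)"

definition torsion_subgroup :: "('a, 'm) monoid_scheme \<Rightarrow> 'a set" where
  "torsion_subgroup G = {x \<in> carrier G. \<exists>n::nat. 0 < n \<and> x [^]\<^bsub>G\<^esub> n = \<one>\<^bsub>G\<^esub>}"

definition real_group :: "real monoid" where
  "real_group = \<lparr>carrier = UNIV, monoid.mult = (+), one = 0\<rparr>"

text \<open>Since \<^const>\<open>hom\<close> leaves the values outside the carrier unconstrained, they are fixed to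
  the neutral element here, so that each homomorphism is represented by exactly one function.
  With this choice (rather than \<^const>\<open>undefined\<close>) the homomorphisms to the reals form a linear
  subspace of the space of all real functions.\<close>

definition Hom :: "('a, 'm) monoid_scheme \<Rightarrow> ('b, 'n) monoid_scheme \<Rightarrow> ('a \<Rightarrow> 'b) set" where
  "Hom G H = {\<phi> \<in> hom G H. \<forall>x. x \<notin> carrier G \<longrightarrow> \<phi> x = \<one>\<^bsub>H\<^esub>}"

abbreviation fun_scale :: "real \<Rightarrow> ('a \<Rightarrow> real) \<Rightarrow> 'a \<Rightarrow> real" where
  "fun_scale c f \<equiv> (\<lambda>x. c * f x)"

lemma vector_space_fun_scale: "vector_space fun_scale"
  by unfold_locales (auto simp: fun_eq_iff algebra_simps)

definition fun_dim :: "('a \<Rightarrow> real) set \<Rightarrow> nat" where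
  "fun_dim = vector_space.dim fun_scale"


definition hyperplane_real :: "('a, 'm) monoid_scheme \<Rightarrow> 'a \<Rightarrow> ('a \<Rightarrow> real) set" where
  "hyperplane_real G \<alpha> = {\<phi> \<in> Hom G real_group. \<phi> \<alpha> = 0}"

definition arrangement_real :: "('a, 'm) monoid_scheme \<Rightarrow> 'a list \<Rightarrow> ('a \<Rightarrow> real) set multiset" where
  "arrangement_real G A = image_mset (hyperplane_real G) (mset A)"

definition intersection_poset :: "'v set \<Rightarrow> 'v set multiset \<Rightarrow> 'v set set" where
  "intersection_poset V M = {V \<inter> \<Inter>(set_mset N) | N. N \<subseteq># M}"

text \<open>The Moebius function \<open>\<mu>(X, Y)\<close> of a finite family of sets \<open>L\<close> ordered by reverse inclusion:
  the interval from \<open>X\<close> up to, but excluding, \<open>Y\<close> consists of the \<open>Z\<close> with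
  \<open>Y \<subset> Z \<subseteq> X\<close>. The value for infinite \<open>L\<close> is a dummy.\<close>

function moebius_rev :: "'v set set \<Rightarrow> 'v set \<Rightarrow> 'v set \<Rightarrow> int" where
  "moebius_rev L X Y =
    (if X = Y then 1
     else if finite L \<and> Y \<subset> X then - (\<Sum>Z\<in>{Z \<in> L. Y \<subset> Z \<and> Z \<subseteq> X}. moebius_rev L X Z)
     else 0)"
  by pat_completeness auto
termination
proof (relation "measure (\<lambda>(L, X, Y). card {Z \<in> L. Y \<subset> Z})")
  fix L :: "'v set set" and X Y Z
  assume "finite L \<and> Y \<subset> X" and Z: "Z \<in> {Z \<in> L. Y \<subset> Z \<and> Z \<subseteq> X}"
  then have "card {W \<in> L. Z \<subset> W} < card {W \<in> L. Y \<subset> W}"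
    by (intro psubset_card_mono) auto
  then show "((L, X, Z), (L, X, Y)) \<in> measure (\<lambda>(L, X, Y). card {Z \<in> L. Y \<subset> Z})"
    by simp
qed simp

declare moebius_rev.simps [simp del]

definition char_poly_real :: "('a, 'm) monoid_scheme \<Rightarrow> 'a list \<Rightarrow> int poly" where
  "char_poly_real G A =
    (let V = Hom G real_group; L = intersection_poset V (arrangement_real G A)
     in \<Sum>Y\<in>L. monom (moebius_rev L V Y) (fun_dim Y))"


definition is_invariant_factors :: "('a, 'm) monoid_scheme \<Rightarrow> nat list \<Rightarrow> bool" where
  "is_invariant_factors G ds \<longleftrightarrow>
    (\<forall>d\<in>set ds. 1 < d) \<and> sorted_wrt (dvd) ds \<and>
    (\<exists>m. G \<cong> sum_group {..<length ds} (\<lambda>i. integer_mod_group (ds ! i))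
            \<times>\<times> sum_group {..<m::nat} (\<lambda>_. integer_group))"

text \<open>For a finitely generated abelian group such a list exists and is unique.\<close>

definition invariant_factors :: "('a, 'm) monoid_scheme \<Rightarrow> nat list" where
  "invariant_factors G = (SOME ds. is_invariant_factors G ds)"

definition max_invariant_factor :: "('a, 'm) monoid_scheme \<Rightarrow> nat" where
  "max_invariant_factor G =
    (if invariant_factors G = [] then 1 else last (invariant_factors G))"

definition lcm_period :: "('a, 'm) monoid_scheme \<Rightarrow> 'a list \<Rightarrow> nat" where
  "lcm_period G B =
    Lcm ((\<lambda>S. max_invariant_factor (G Mod generate G (set S))) ` set (subseqs B))"

definition chromatic_quasi :: "('a, 'm) monoid_scheme \<Rightarrow> 'a list \<Rightarrow> nat \<Rightarrow> nat" where
  "chromatic_quasi G B q =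
    card {\<phi> \<in> Hom G (integer_mod_group q). \<forall>\<beta>\<in>set B. \<phi> \<beta> \<noteq> \<one>\<^bsub>integer_mod_group q\<^esub>}"

definition first_constituent :: "('a, 'm) monoid_scheme \<Rightarrow> 'a list \<Rightarrow> int poly" where
  "first_constituent G B =
    (THE f. \<forall>q>0. [q = 1] (mod lcm_period G B) \<longrightarrow> int (chromatic_quasi G B q) = poly f (int q))"

end

theory Submission
  imports Defs "HOL-Algebra.FiniteProduct"
begin

text \<open>Both sides equal \<open>\<Sum>\<^sub>S (-1)\<^bsup>|S|\<^esup> t\<^bsup>r(S)\<^esup>\<close>, where \<open>S\<close> ranges over the sets of
  non-torsion elements of the list and \<open>r(S)\<close> is the rank of \<open>\<Gamma>/\<langle>S\<rangle>\<close>. For the characteristic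
  polynomial this is Whitney's theorem; it needs that \<open>H\<^sub>\<alpha>\<close> is a proper subspace exactly for
  non-torsion \<open>\<alpha>\<close>. For the chromatic quasi-polynomial it is inclusion-exclusion: if \<open>q \<equiv> 1\<close> modulo
  the LCM-period, then \<open>q\<close> is coprime to the torsion of every \<open>\<Gamma>/\<langle>S\<rangle>\<close>, so
  \<open>Hom(\<Gamma>/\<langle>S\<rangle>, \<int>/q)\<close> has \<open>q\<^bsup>r(S)\<^esup>\<close> elements. These \<open>q\<close> determine the polynomial because the
  period is positive, which rests on the existence of invariant factors.\<close>

section \<open>Existence of invariant factors\<close>

text \<open>Homomorphisms from \<open>\<int>\<^sup>n\<close> to \<open>G\<close>; vectors are functions on all of \<open>nat\<close>, of which only the
  first \<open>n\<close> coordinates matter.\<close>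

definition int_vec_hom ::
  "('a, 'm) monoid_scheme \<Rightarrow> nat \<Rightarrow> ((nat \<Rightarrow> int) \<Rightarrow> 'a) \<Rightarrow> bool" where
  "int_vec_hom G n \<psi> \<longleftrightarrow> (\<forall>a. \<psi> a \<in> carrier G) \<and>
    (\<forall>a b. \<psi> (\<lambda>i. a i + b i) = \<psi> a \<otimes>\<^bsub>G\<^esub> \<psi> b) \<and>
    (\<forall>a b. (\<forall>i<n. a i = b i) \<longrightarrow> \<psi> a = \<psi> b)"

lemma int_vec_homD:
  assumes "int_vec_hom G n \<psi>"
  shows int_vec_hom_closed: "\<psi> a \<in> carrier G"
    and int_vec_hom_add: "\<psi> (\<lambda>i. a i + b i) = \<psi> a \<otimes>\<^bsub>G\<^esub> \<psi> b"
    and int_vec_hom_cong: "(\<And>i. i < n \<Longrightarrow> a i = b i) \<Longrightarrow> \<psi> a = \<psi> b"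
  using assms unfolding int_vec_hom_def by blast+

text \<open>All base changes below are instances. Vectors are infinite sequences, so the last
  hypothesis states that the first \<open>n\<close> entries of \<open>W a\<close> see only the first
  \<open>n\<close> entries of \<open>a\<close>.\<close>

lemma int_vec_hom_comp:
  assumes "int_vec_hom G n \<psi>"
    and "\<And>a b. W (\<lambda>i. a i + b i) = (\<lambda>i. W a i + W b i)"
    and "\<And>a b i. (\<And>i. i < n \<Longrightarrow> a i = b i) \<Longrightarrow> i < n \<Longrightarrow> W a i = W b i"
  shows "int_vec_hom G n (\<lambda>a. \<psi> (W a))"
  unfolding int_vec_hom_def
proof (intro conjI allI impI)
  show "\<psi> (W a) \<in> carrier G" for a
    using int_vec_hom_closed[OF assms(1)] .
  show "\<psi> (W (\<lambda>i. a i + b i)) = \<psi> (W a) \<otimes>\<^bsub>G\<^esub> \<psi> (W b)" for a b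
    by (simp add: assms(2) int_vec_hom_add[OF assms(1)])
  show "\<psi> (W a) = \<psi> (W b)" if "\<forall>i<n. a i = b i" for a b
    using that by (intro int_vec_hom_cong[OF assms(1)] assms(3)) auto
qed

section \<open>Relations between generators and their diagonal form\<close>

context comm_group
begin

lemma int_vec_hom_zero:
  assumes "int_vec_hom G n \<psi>"
  shows "\<psi> (\<lambda>i. 0) = \<one>"
  using int_vec_hom_add[OF assms, of "\<lambda>i. 0" "\<lambda>i. 0"] int_vec_hom_closed[OF assms, of "\<lambda>i. 0"]
  by (simp add: r_cancel_one)

lemma int_vec_hom_scale:
  assumes "int_vec_hom G n \<psi>"
  shows "\<psi> (\<lambda>i. k * a i) = \<psi> a [^] (k::int)"
proof -
  note closed = int_vec_hom_closed[OF assms]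
  have nat: "\<psi> (\<lambda>i. int m * a i) = \<psi> a [^] m" for m
  proof (induction m)
    case (Suc m)
    then show ?case
      using int_vec_hom_add[OF assms, of "\<lambda>i. int m * a i" a]
      by (simp add: distrib_right add.commute)
  qed (simp add: int_vec_hom_zero[OF assms])
  show ?thesis
  proof (cases k rule: int_cases2)
    case (nonneg m)
    then show ?thesis by (simp only: nat int_pow_int)
  next
    case (nonpos m)
    have "\<psi> (\<lambda>i. - int m * a i) \<otimes> \<psi> (\<lambda>i. int m * a i) = \<one>"
      using int_vec_hom_add[OF assms, of "\<lambda>i. - int m * a i" "\<lambda>i. int m * a i"]
        int_vec_hom_zero[OF assms] by simp
    from inv_equality[OF this closed closed]
    have "\<psi> (\<lambda>i. - int m * a i) = inv (\<psi> a [^] m)"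
      by (simp only: nat)
    then show ?thesis using closed by (simp only: nonpos int_pow_neg int_pow_int)
  qed
qed

lemma int_vec_hom_diff_kernel:
  assumes "int_vec_hom G n \<psi>" "\<psi> a = \<one>" "\<psi> b = \<one>"
  shows "\<psi> (\<lambda>i. a i - k * b i) = \<one>"
proof -
  have "\<psi> (\<lambda>i. a i + (-k) * b i) = \<one>"
    using int_vec_hom_add[OF assms(1), of a "\<lambda>i. (-k) * b i"] int_vec_hom_scale[OF assms(1), of "-k" b]
      assms(2,3) by simp
  then show ?thesis by simp
qed

text \<open>The last coefficient \<open>d\<close> is minimal among all relations of all presentations with the same
  image; a base change of \<open>\<int>\<^sup>n\<^sup>+\<^sup>1\<close> (a Euclidean step) would otherwise produce a smaller one, so
  \<open>d\<close> divides every coefficient of a relation in which it occurs.\<close>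

definition minimal_presentation ::
  "nat \<Rightarrow> ((nat \<Rightarrow> int) \<Rightarrow> 'a) \<Rightarrow> nat \<Rightarrow> bool" where
  "minimal_presentation n \<psi> d \<longleftrightarrow> int_vec_hom G (Suc n) \<psi> \<and> 0 < d \<and>
    (\<forall>\<chi> a. int_vec_hom G (Suc n) \<chi> \<longrightarrow> range \<chi> = range \<psi> \<longrightarrow> \<chi> a = \<one> \<longrightarrow> 0 < a n \<longrightarrow> int d \<le> a n)"

text \<open>Otherwise division with remainder yields a relation with last coefficient
  \<open>a i mod int d\<close>, positive and below \<open>d\<close>. Since \<open>\<chi>\<close> may
  differ from \<open>\<psi>\<close>, the lemma also covers presentations built later with the same
  range.\<close>

lemma minimal_presentation_dvd:
  assumes min: "minimal_presentation n \<psi> d" and \<chi>: "int_vec_hom G (Suc n) \<chi>" "range \<chi> = range \<psi>"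
    and a: "\<chi> a = \<one>" "a n = int d" and i: "i < n"
  shows "int d dvd a i"
proof (rule ccontr)
  assume nd: "\<not> int d dvd a i"
  define q where "q = a i div int d"
  \<comment> \<open>\<open>W\<close> inverts the Euclidean step that swaps entries \<open>i\<close>
    and \<open>n\<close> and subtracts \<open>q\<close> times the old entry \<open>n\<close>; hence
    the stepped vector \<open>?b\<close> is a relation of the composite.\<close>
  define W where "W = (\<lambda>(b::nat\<Rightarrow>int). b(n := b i, i := b n + q * b i))"
  have d: "0 < d" using min by (simp add: minimal_presentation_def)
  have W: "W (b(i := b n, n := b i - q * b n)) = b" for b
    using i by (auto simp: W_def fun_eq_iff)
  have h: "int_vec_hom G (Suc n) (\<lambda>b. \<chi> (W b))"
    using i by (intro int_vec_hom_comp[OF \<chi>(1)]) (auto simp: W_def fun_eq_iff algebra_simps less_Suc_eq)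
  have "surj W" by (rule surjI[where f = "\<lambda>b. b(i := b n, n := b i - q * b n)"]) (rule W)
  then have r: "range (\<lambda>b. \<chi> (W b)) = range \<psi>" unfolding \<chi>(2)[symmetric] by (metis image_image)
  let ?b = "a(i := a n, n := a i - q * a n)"
  have b: "?b n = a i mod int d"
    using i a(2) by (simp add: q_def minus_div_mult_eq_mod)
  have "0 < ?b n"
    unfolding b using nd d by (metis dvd_eq_mod_eq_0 of_nat_0_less_iff order_le_less pos_mod_sign)
  moreover have "\<chi> (W ?b) = \<one>" using W a(1) by simp
  ultimately have "int d \<le> ?b n" using min h r unfolding minimal_presentation_def by blast
  then show False unfolding b using pos_mod_bound[of "int d" "a i"] d by linarith
qed

text \<open>A transposition moves the nonzero coefficient to position \<open>n\<close> and
  \<open>sgn\<close> makes it positive, so positive last coefficients occur. The least one over all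
  presentations with this range is \<open>d\<close>.\<close>

lemma minimal_presentation_exists:
  assumes \<psi>: "int_vec_hom G (Suc n) \<psi>" and a: "\<psi> a = \<one>" "a k \<noteq> 0" "k \<le> n"
  obtains \<chi> d b where "minimal_presentation n \<chi> d" "range \<chi> = range \<psi>" "\<chi> b = \<one>" "b n = int d"
proof -
  define P where "P = (\<lambda>d. 0 < d \<and> (\<exists>\<chi> b. int_vec_hom G (Suc n) \<chi> \<and> range \<chi> = range \<psi> \<and> \<chi> b = \<one> \<and> b n = int d))"
  have "\<exists>d. P d"
  proof -
    define W where "W = (\<lambda>(b::nat\<Rightarrow>int). b(n := b k, k := b n))"
    have WW: "W (W b) = b" for b by (auto simp: W_def fun_eq_iff)
    have h: "int_vec_hom G (Suc n) (\<lambda>b. \<psi> (W b))"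
      using a by (intro int_vec_hom_comp[OF \<psi>]) (auto simp: W_def fun_eq_iff algebra_simps)
    have "surj W" by (rule surjI[where f = W]) (rule WW)
    then have r: "range (\<lambda>b. \<psi> (W b)) = range \<psi>" by (metis image_image)
    define c where "c = (\<lambda>i. sgn (a k) * W a i)"
    have "(\<lambda>i. sgn (a k) * a i) = W c" using WW by (auto simp: c_def W_def fun_eq_iff)
    then have "\<psi> (W c) = \<one>"
      using int_vec_hom_scale[OF \<psi>, of "sgn (a k)" a] a(1) by simp
    moreover have "c n = int (nat \<bar>a k\<bar>)" using a(2) by (auto simp: c_def W_def sgn_if)
    moreover have "0 < nat \<bar>a k\<bar>" using a by simp
    ultimately show ?thesis using h r unfolding P_def by blast
  qed
  then have L: "P (LEAST d. P d)" by (auto intro: LeastI_ex)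
  let ?d = "LEAST d. P d"
  obtain \<chi> b where \<chi>: "int_vec_hom G (Suc n) \<chi>" "range \<chi> = range \<psi>" "\<chi> b = \<one>" "b n = int ?d" "0 < ?d"
    using L unfolding P_def by blast
  moreover have "minimal_presentation n \<chi> ?d"
    unfolding minimal_presentation_def
  proof (intro conjI allI impI)
    fix \<xi> c assume *: "int_vec_hom G (Suc n) \<xi>" "range \<xi> = range \<chi>" "\<xi> c = \<one>" "0 < c n"
    then have "P (nat (c n))" unfolding P_def using \<chi>(2) by (metis int_nat_eq less_le zero_less_nat_eq)
    then have "?d \<le> nat (c n)" by (rule Least_le)
    then show "int ?d \<le> c n" using *(4) by linarith
  qed (use \<chi> in auto)
  ultimately show thesis using that by blast
qed

text \<open>This is the Smith normal form of the relations; \<open>d i = 0\<close> marks a free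
  coordinate. The smallest coefficient is split off at the last position, hence later entries divide
  earlier ones. Surjectivity onto \<open>G\<close> is not assumed, so that the induction can pass to
  a subgroup.\<close>

lemma int_vec_hom_diagonal:
  assumes "int_vec_hom G n \<psi>"
  shows "\<exists>\<chi> d. int_vec_hom G n \<chi> \<and> range \<chi> = range \<psi> \<and>
    (\<forall>c. \<chi> c = \<one> \<longleftrightarrow> (\<forall>i<n. int (d i) dvd c i)) \<and> (\<forall>i j. i < j \<longrightarrow> j < n \<longrightarrow> d j dvd d i)"
  using assms
proof (induction n arbitrary: \<psi>)
  case 0
  have "\<psi> c = \<one>" for c
    using int_vec_hom_cong[OF 0, of c "\<lambda>i. 0"] int_vec_hom_zero[OF 0] by simp
  then show ?case using 0 by (intro exI[of _ \<psi>] exI[of _ "\<lambda>i. 0"]) auto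
next
  case (Suc n)
  show ?case
  proof (cases "\<forall>a. \<psi> a = \<one> \<longrightarrow> (\<forall>k\<le>n. a k = 0)")
    case True
    have "\<psi> c = \<one>" if "\<forall>k\<le>n. c k = 0" for c
      using int_vec_hom_cong[OF Suc.prems, of c "\<lambda>i. 0"] int_vec_hom_zero[OF Suc.prems] that by simp
    then show ?thesis using True Suc.prems
      by (intro exI[of _ \<psi>] exI[of _ "\<lambda>i. 0"]) (auto simp: less_Suc_eq_le)
  next
    case False
    then obtain \<chi>0 d a where \<chi>0: "minimal_presentation n \<chi>0 d" "range \<chi>0 = range \<psi>" "\<chi>0 a = \<one>" "a n = int d"
      using minimal_presentation_exists[OF Suc.prems] by metis
    then have d: "0 < d" and h0: "int_vec_hom G (Suc n) \<chi>0"
      by (auto simp: minimal_presentation_def)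
    have da: "int d dvd a i" if "i < n" for i
      using minimal_presentation_dvd[OF \<chi>0(1) h0] \<chi>0 that by blast
    \<comment> \<open>As \<open>d\<close> divides every \<open>a i\<close>, this shear sends
      \<open>d\<close> times the last unit vector to the relation \<open>a\<close> (on the entries
      that matter). That multiple is therefore a relation of \<open>\<chi>\<close>.\<close>
    define W where "W = (\<lambda>b i. if i < n then b i + (a i div int d) * b n else (b i :: int))"
    define \<chi> where "\<chi> = (\<lambda>b. \<chi>0 (W b))"
    have h: "int_vec_hom G (Suc n) \<chi>"
      unfolding \<chi>_def
      by (intro int_vec_hom_comp[OF h0]) (auto simp: W_def fun_eq_iff algebra_simps)
    have "surj W"
      by (rule surjI[where f = "\<lambda>b i. if i < n then b i - (a i div int d) * b n else b i"])
        (auto simp: W_def fun_eq_iff)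
    then have r: "range \<chi> = range \<psi>" unfolding \<chi>_def using \<chi>0(2) by (metis image_image)
    then have min: "minimal_presentation n \<chi> d"
      using \<chi>0(1,2) h unfolding minimal_presentation_def by simp
    define u where "u = (\<lambda>(k::int) i. if i = n then k else 0)"
    have "\<chi> (u d) = \<chi>0 a"
      unfolding \<chi>_def
      by (rule int_vec_hom_cong[OF h0]) (use da \<chi>0(4) in \<open>auto simp: W_def u_def less_Suc_eq\<close>)
    then have ud: "\<chi> (u d) = \<one>" using \<chi>0(3) by simp
    \<comment> \<open>Subtracting a multiple of the relation \<open>u d\<close> leaves the remainder
      modulo \<open>d\<close> as last coefficient; minimality forces it to vanish.\<close>
    have dn: "int d dvd b n" if "\<chi> b = \<one>" for b
    proof (rule ccontr)
      assume nd: "\<not> int d dvd b n"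
      let ?c = "\<lambda>i. b i - (b n div int d) * u d i"
      have c: "\<chi> ?c = \<one>" by (rule int_vec_hom_diff_kernel[OF h that ud])
      have cn: "?c n = b n mod int d" by (simp add: u_def minus_div_mult_eq_mod)
      have "0 < ?c n"
        unfolding cn using nd d by (metis dvd_eq_mod_eq_0 of_nat_0_less_iff order_le_less pos_mod_sign)
      then have "int d \<le> ?c n" using min h c unfolding minimal_presentation_def by blast
      then show False unfolding cn using pos_mod_bound[of "int d" "b n"] d by linarith
    qed
    \<comment> \<open>The induction hypothesis is applied to the subgroup generated by the images of
      the first \<open>n\<close> unit vectors.\<close>
    define T where "T = (\<lambda>(b::nat \<Rightarrow> int) i. if i < n then b i else 0)"
    have hT: "int_vec_hom G n (\<lambda>b. \<chi> (T b))"
      unfolding int_vec_hom_def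
    proof (intro conjI allI impI)
      show "\<chi> (T a) \<in> carrier G" for a using int_vec_hom_closed[OF h] .
      show "\<chi> (T (\<lambda>i. a i + b i)) = \<chi> (T a) \<otimes> \<chi> (T b)" for a b
        unfolding int_vec_hom_add[OF h, symmetric]
        by (rule arg_cong[of _ _ \<chi>]) (auto simp: T_def)
      show "\<chi> (T a) = \<chi> (T b)" if "\<forall>i<n. a i = b i" for a b
        by (rule arg_cong[of _ _ \<chi>]) (use that in \<open>auto simp: T_def\<close>)
    qed
    obtain \<xi> e where \<xi>: "int_vec_hom G n \<xi>" "range \<xi> = range (\<lambda>b. \<chi> (T b))"
        "\<And>c. \<xi> c = \<one> \<longleftrightarrow> (\<forall>i<n. int (e i) dvd c i)" "\<And>i j. i < j \<Longrightarrow> j < n \<Longrightarrow> e j dvd e i"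
      using Suc.IH[OF hT] by blast
    \<comment> \<open>The diagonal presentation of that subgroup is joined with the last coordinate
      of \<open>\<chi>\<close>.\<close>
    define \<eta> where "\<eta> = (\<lambda>c. \<xi> c \<otimes> \<chi> (u (c n)))"
    define f where "f = e(n := d)"
    have u_add: "\<chi> (u (k + l)) = \<chi> (u k) \<otimes> \<chi> (u l)" for k l
      unfolding int_vec_hom_add[OF h, symmetric]
      by (rule arg_cong[of _ _ \<chi>]) (auto simp: u_def)
    note [simp] = int_vec_hom_closed[OF h] int_vec_hom_closed[OF \<xi>(1)]
    have h\<eta>: "int_vec_hom G (Suc n) \<eta>"
      unfolding int_vec_hom_def
    proof (intro conjI allI impI)
      show "\<eta> a \<in> carrier G" for a by (simp add: \<eta>_def)
      show "\<eta> (\<lambda>i. a i + b i) = \<eta> a \<otimes> \<eta> b" for a b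
        by (simp add: \<eta>_def int_vec_hom_add[OF \<xi>(1)] u_add m_ac)
      show "\<eta> a = \<eta> b" if "\<forall>i<Suc n. a i = b i" for a b
        using int_vec_hom_cong[OF \<xi>(1), of a b] that by (simp add: \<eta>_def)
    qed
    have split: "\<chi> (T b) \<otimes> \<chi> (u k) = \<chi> (\<lambda>i. T b i + u k i)" for b k
      by (rule int_vec_hom_add[OF h, symmetric])
    have rng: "range \<eta> = range \<chi>"
    proof (intro equalityI subsetI; elim rangeE)
      fix y c assume y: "y = \<eta> c"
      obtain b where "\<xi> c = \<chi> (T b)" using \<xi>(2) by blast
      then show "y \<in> range \<chi>" unfolding y \<eta>_def using split by simp
    next
      fix y b assume y: "y = \<chi> b"
      obtain c where c: "\<xi> c = \<chi> (T b)" using \<xi>(2) by (metis imageE rangeI)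
      have "\<xi> (c(n := b n)) = \<xi> c" by (rule int_vec_hom_cong[OF \<xi>(1)]) auto
      then have "\<eta> (c(n := b n)) = \<chi> (\<lambda>i. T b i + u (b n) i)" by (simp add: \<eta>_def c split)
      also have "\<dots> = y" unfolding y by (rule int_vec_hom_cong[OF h]) (auto simp: T_def u_def)
      finally show "y \<in> range \<eta>" by blast
    qed
    have ker: "\<eta> c = \<one> \<longleftrightarrow> (\<forall>i<Suc n. int (f i) dvd c i)" for c
    proof -
      have un: "\<chi> (u (c n)) = \<one>" if dvd: "int d dvd c n"
      proof -
        obtain k where k: "c n = int d * k" using dvd by (auto simp: dvd_def)
        have "\<chi> (u (c n)) = \<chi> (\<lambda>i. k * u d i)"
          by (rule arg_cong[of _ _ \<chi>]) (auto simp: u_def k)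
        then show ?thesis by (simp add: int_vec_hom_scale[OF h] ud)
      qed
      \<comment> \<open>Via \<open>\<xi> c = \<chi> (T b)\<close>, a relation of
        \<open>\<eta>\<close> becomes a relation of \<open>\<chi>\<close> with the same last
        coefficient, so \<open>dn\<close> applies.\<close>
      have "int d dvd c n" if "\<eta> c = \<one>"
      proof -
        obtain b where b: "\<xi> c = \<chi> (T b)" using \<xi>(2) by blast
        then have "\<chi> (\<lambda>i. T b i + u (c n) i) = \<one>" using that split unfolding \<eta>_def by simp
        from dn[OF this] show ?thesis by (simp add: T_def u_def)
      qed
      then have "\<eta> c = \<one> \<longleftrightarrow> int d dvd c n \<and> \<xi> c = \<one>" using un by (auto simp: \<eta>_def)
      then show ?thesis using \<xi>(3) by (auto simp: f_def less_Suc_eq)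
    qed
    have chain: "f j dvd f i" if "i < j" "j < Suc n" for i j
    proof (cases "j = n")
      case True
      \<comment> \<open>By \<open>ker\<close> this vector is a relation of \<open>\<eta>\<close>.
        Its last coefficient is the minimal \<open>d\<close>, which therefore divides its entry
        \<open>e i\<close>.\<close>
      let ?c = "\<lambda>k. if k = i then int (e i) else u d k"
      have "\<eta> ?c = \<one>" unfolding ker using that True by (auto simp: f_def u_def)
      then have "int d dvd ?c i"
        using True that
        by (intro minimal_presentation_dvd[OF min h\<eta> rng]) (auto simp: u_def)
      then show ?thesis using True that by (auto simp: f_def)
    next
      case False
      then show ?thesis using \<xi>(4) that by (auto simp: f_def)
    qed
    show ?thesis using h\<eta> rng r ker chain by (intro exI[of _ \<eta>] exI[of _ f]) auto
  qed
qed

end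

section \<open>Decomposition of a finitely generated abelian group\<close>

lemma carrier_sum_group_finite:
  assumes "finite I" "\<And>i. i \<in> I \<Longrightarrow> group (G i)"
  shows "carrier (sum_group I G) = (\<Pi>\<^sub>E i\<in>I. carrier (G i))"
  using assms by (auto simp: carrier_sum_group)

context comm_group
begin

lemma int_vec_hom_eq_iff:
  assumes "int_vec_hom G n \<psi>"
  shows "\<psi> a = \<psi> b \<longleftrightarrow> \<psi> (\<lambda>i. a i - b i) = \<one>"
proof -
  have "\<psi> a = \<psi> (\<lambda>i. a i - b i) \<otimes> \<psi> b"
    using int_vec_hom_add[OF assms, of "\<lambda>i. a i - b i" b] by simp
  then show ?thesis using int_vec_hom_closed[OF assms] by (simp add: r_cancel_one')
qed

lemma finitely_generated_int_vec_hom: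
  assumes "finitely_generated G"
  obtains n \<psi> where "int_vec_hom G n \<psi>" "range \<psi> = carrier G"
proof -
  obtain S where S: "finite S" "S \<subseteq> carrier G" "generate G S = carrier G"
    using assms unfolding finitely_generated_def by blast
  obtain xs where xs: "set xs = S" using S(1) finite_list by blast
  define n where "n = length xs"
  have x: "xs ! i \<in> carrier G" if "i < n" for i
    using that xs S(2) by (auto simp: n_def)
  define \<psi> where "\<psi> = (\<lambda>a::nat\<Rightarrow>int. finprod G (\<lambda>i. xs ! i [^] a i) {..<n})"
  have \<psi>: "int_vec_hom G n \<psi>"
    unfolding int_vec_hom_def
  proof (intro conjI allI impI)
    show "\<psi> a \<in> carrier G" for a
      unfolding \<psi>_def by (rule finprod_closed) (auto simp: x)
    show "\<psi> (\<lambda>i. a i + b i) = \<psi> a \<otimes> \<psi> b" for a b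
      unfolding \<psi>_def
      by (subst finprod_multf[symmetric]) (auto simp: x int_pow_mult simp del: finprod_multf intro!: finprod_cong')
    show "\<psi> a = \<psi> b" if "\<forall>i<n. a i = b i" for a b
      unfolding \<psi>_def by (rule finprod_cong') (use that x in auto)
  qed
  have unit: "\<exists>a. \<psi> a = s" if s: "s \<in> S" for s
  proof -
    obtain i where i: "i < n" "xs ! i = s"
      using s unfolding xs[symmetric] n_def by (metis in_set_conv_nth)
    have "\<psi> (\<lambda>j. if i = j then 1 else 0) = finprod G (\<lambda>j. if i = j then xs ! j else \<one>) {..<n}"
      unfolding \<psi>_def by (rule finprod_cong') (use x in auto)
    also have "\<dots> = s" using i x finprod_singleton[of i "{..<n}" "\<lambda>j. xs ! j"] by auto
    finally show ?thesis by blast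
  qed
  have "\<exists>a. \<psi> a = y" if "y \<in> generate G S" for y
    using that
  proof induction
    case one
    then show ?case using int_vec_hom_zero[OF \<psi>] by blast
  next
    case (incl h)
    then show ?case by (rule unit)
  next
    case (inv h)
    then obtain a where a: "\<psi> a = h" using unit by blast
    have "\<psi> (\<lambda>i. -1 * a i) = inv h"
      unfolding int_vec_hom_scale[OF \<psi>] a using inv S(2) by (auto simp: int_pow_neg)
    then show ?case by blast
  next
    case (eng h1 h2)
    then show ?case using int_vec_hom_add[OF \<psi>] by metis
  qed
  then have "range \<psi> = carrier G"
    using S(3) int_vec_hom_closed[OF \<psi>] by blast
  then show thesis using that \<psi> by blast
qed

text \<open>A diagonal presentation identifies \<open>G\<close> with a product of cyclic groups of
  orders \<open>d i\<close>, where order \<open>0\<close> means infinite cyclic; it remains to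
  discard the trivial factors and sort.\<close>

lemma invariant_factors_exist:
  assumes "int_vec_hom G n \<psi>0" "range \<psi>0 = carrier G"
  shows "\<exists>ds. is_invariant_factors G ds"
proof -
  obtain \<chi> d where \<chi>: "int_vec_hom G n \<chi>" "range \<chi> = carrier G"
    "\<And>c. \<chi> c = \<one> \<longleftrightarrow> (\<forall>i<n. int (d i) dvd c i)" "\<And>i j. i < j \<Longrightarrow> j < n \<Longrightarrow> d j dvd d i"
    using int_vec_hom_diagonal[OF assms(1)] unfolding assms(2) by blast
  \<comment> \<open>Reversing the indices makes earlier entries divide later ones, the order
    required by \<open>is_invariant_factors\<close>.\<close>
  define D where "D = (\<lambda>i. d (n - 1 - i))"
  define \<psi> where "\<psi> = (\<lambda>c. \<chi> (\<lambda>i. if i < n then c (n - 1 - i) else 0))"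
  have chain: "D i dvd D j" if "i \<le> j" "j < n" for i j
    using that \<chi>(4)[of "n - 1 - j" "n - 1 - i"] by (cases "i = j") (auto simp: D_def)
  have \<psi>: "int_vec_hom G n \<psi>"
    unfolding \<psi>_def
    by (intro int_vec_hom_comp[OF \<chi>(1)]) (auto simp: fun_eq_iff)
  have \<psi>_eq: "\<psi> a = \<psi> b \<longleftrightarrow> (\<forall>i<n. int (D i) dvd a i - b i)" for a b
  proof -
    have "\<psi> c = \<one> \<longleftrightarrow> (\<forall>i<n. int (D i) dvd c i)" for c
    proof -
      have "(\<forall>i<n. int (d i) dvd c (n - 1 - i)) \<longleftrightarrow> (\<forall>i<n. int (D i) dvd c i)"
      proof (intro iffI allI impI)
        fix i assume *: "\<forall>i<n. int (d i) dvd c (n - 1 - i)" and "i < n"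
        then show "int (D i) dvd c i" using *[rule_format, of "n - 1 - i"] by (simp add: D_def)
      next
        fix i assume *: "\<forall>i<n. int (D i) dvd c i" and "i < n"
        then show "int (d i) dvd c (n - 1 - i)" using *[rule_format, of "n - 1 - i"] by (simp add: D_def)
      qed
      then show ?thesis by (simp add: \<psi>_def \<chi>(3))
    qed
    then show ?thesis using int_vec_hom_eq_iff[OF \<psi>] by simp
  qed
  have \<psi>_surj: "\<exists>c. \<psi> c = y" if y: "y \<in> carrier G" for y
  proof -
    obtain c where c: "y = \<chi> c" using \<chi>(2) y by blast
    have "\<psi> (\<lambda>i. c (n - 1 - i)) = y"
      unfolding \<psi>_def c by (rule int_vec_hom_cong[OF \<chi>(1)]) auto
    then show ?thesis by blast
  qed
  \<comment> \<open>In the chain the ones come first and the zeros last. The block from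
    \<open>k0\<close> up to \<open>k1\<close> holds the invariant factors, and the zeros from
    \<open>k1\<close> on give the infinite cyclic summands. The disjunct \<open>n \<le> k\<close>
    supplies \<open>n\<close> as default.\<close>
  define k0 where "k0 = (LEAST k. n \<le> k \<or> D k \<noteq> 1)"
  define k1 where "k1 = (LEAST k. n \<le> k \<or> D k = 0)"
  have k0: "n \<le> k0 \<or> D k0 \<noteq> 1" unfolding k0_def by (rule LeastI[of _ n]) simp
  have k1: "n \<le> k1 \<or> D k1 = 0" unfolding k1_def by (rule LeastI[of _ n]) simp
  have k1n: "k1 \<le> n" unfolding k1_def by (rule Least_le) simp
  have k01: "k0 \<le> k1" using k1 unfolding k0_def by (intro Least_le) auto
  have lt0: "D i = 1" if "i < k0" for i using not_less_Least[OF that[unfolded k0_def]] by simp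
  have lt1: "D i \<noteq> 0" if "i < k1" for i using not_less_Least[OF that[unfolded k1_def]] by simp
  have ge0: "D i \<noteq> 1" if "k0 \<le> i" "i < n" for i using k0 chain[OF that] that by auto
  have ge1: "D i = 0" if "k1 \<le> i" "i < n" for i using k1 chain[OF that] that by auto
  define ds where "ds = map D [k0..<k1]"
  define m where "m = n - k1"
  have len: "length ds = k1 - k0" and nth: "\<And>i. i < k1 - k0 \<Longrightarrow> ds ! i = D (k0 + i)"
    by (auto simp: ds_def)
  let ?A = "sum_group {..<length ds} (\<lambda>i. integer_mod_group (ds ! i))"
  let ?B = "sum_group {..<m} (\<lambda>_. integer_group)"
  let ?P = "?A \<times>\<times> ?B"
  have cA: "carrier ?A = (\<Pi>\<^sub>E i\<in>{..<k1-k0}. {0..<int (D (k0 + i))})"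
  proof -
    \<comment> \<open>Nonzero moduli matter here, since \<open>integer_mod_group 0\<close> is the
      group of all integers.\<close>
    have "carrier (integer_mod_group (ds ! i)) = {0..<int (D (k0 + i))}" if "i < k1 - k0" for i
      using lt1[of "k0 + i"] that by (simp add: nth carrier_integer_mod_group)
    then show ?thesis by (subst carrier_sum_group_finite) (auto simp: len intro!: PiE_cong)
  qed
  have cB: "carrier ?B = (\<Pi>\<^sub>E i\<in>{..<m}. UNIV)"
    by (subst carrier_sum_group_finite) auto
  have grp: "group ?P" by (intro DirProd_group sum_group) auto
  \<comment> \<open>Coordinates with \<open>D i = 1\<close> are irrelevant and filled with
    \<open>0\<close>. Residues are read as integers, so \<open>W\<close> is additive only up to
    relations of \<open>\<psi>\<close>, which suffices.\<close>
  define W where "W = (\<lambda>p i. if i < k0 then 0 else if i < k1 then fst p (i - k0)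
     else (snd p (i - k1) :: int))"
  have hom: "(\<lambda>p. \<psi> (W p)) \<in> hom ?P G"
  proof (rule homI)
    show "\<psi> (W p) \<in> carrier G" for p by (rule int_vec_hom_closed[OF \<psi>])
    fix p p' assume "p \<in> carrier ?P" "p' \<in> carrier ?P"
    show "\<psi> (W (p \<otimes>\<^bsub>?P\<^esub> p')) = \<psi> (W p) \<otimes> \<psi> (W p')"
      unfolding int_vec_hom_add[OF \<psi>, symmetric] \<psi>_eq
    proof (intro allI impI)
      fix i assume i: "i < n"
      consider "i < k0" | "k0 \<le> i" "i < k1" | "k1 \<le> i" using k01 by linarith
      then show "int (D i) dvd W (p \<otimes>\<^bsub>?P\<^esub> p') i - (W p i + W p' i)"
      proof cases
        case 2
        then have "i - k0 < k1 - k0" "k0 + (i - k0) = i" by auto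
        then have "W (p \<otimes>\<^bsub>?P\<^esub> p') i = (W p i + W p' i) mod int (D i)"
          using 2 by (simp add: W_def mult_DirProd' len nth)
        then show ?thesis by (simp add: mod_eq_dvd_iff[symmetric])
      next
        case 3
        then have "i - k1 < m" using i by (auto simp: m_def)
        then show ?thesis using 3 k01 by (simp add: W_def mult_DirProd')
      qed (use k01 in \<open>auto simp: W_def\<close>)
    qed
  qed
  have inj: "inj_on (\<lambda>p. \<psi> (W p)) (carrier ?P)"
  proof (rule inj_onI)
    fix p p' assume p: "p \<in> carrier ?P" "p' \<in> carrier ?P" and eq: "\<psi> (W p) = \<psi> (W p')"
    then have dv: "int (D i) dvd W p i - W p' i" if "i < n" for i using \<psi>_eq that by blast
    have "fst p \<in> carrier ?A" "fst p' \<in> carrier ?A" "snd p \<in> carrier ?B" "snd p' \<in> carrier ?B"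
      using p by auto
    note c = this[unfolded cA cB]
    have "fst p = fst p'"
    proof (rule PiE_ext[OF c(1,2)])
      fix i assume i: "i \<in> {..<k1-k0}"
      then have "k0 + i < k1" "k0 + i < n" using k1n by auto
      then have "int (D (k0 + i)) dvd fst p i - fst p' i"
        using dv[of "k0 + i"] by (simp add: W_def)
      then have "fst p i mod int (D (k0 + i)) = fst p' i mod int (D (k0 + i))"
        by (simp add: mod_eq_dvd_iff)
      moreover have "fst p i \<in> {0..<int (D (k0 + i))}" "fst p' i \<in> {0..<int (D (k0 + i))}"
        using PiE_mem[OF c(1) i] PiE_mem[OF c(2) i] .
      ultimately show "fst p i = fst p' i" by simp
    qed
    moreover have "snd p = snd p'"
    proof (rule PiE_ext[OF c(3,4)])
      fix i assume "i \<in> {..<m}"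
      then have "k1 + i < n" by (auto simp: m_def)
      then show "snd p i = snd p' i"
        using dv[of "k1 + i"] ge1[of "k1 + i"] k01 by (simp add: W_def)
    qed
    ultimately show "p = p'" by (rule prod_eqI)
  qed
  have surj: "carrier G \<subseteq> (\<lambda>p. \<psi> (W p)) ` carrier ?P"
  proof
    fix y assume "y \<in> carrier G"
    then obtain c where c: "\<psi> c = y" using \<psi>_surj by blast
    let ?p = "(\<lambda>i\<in>{..<k1-k0}. c (k0 + i) mod int (D (k0 + i)), \<lambda>i\<in>{..<m}. c (k1 + i))"
    have "fst ?p \<in> carrier ?A" "snd ?p \<in> carrier ?B"
      unfolding cA cB using lt1 by (auto simp: less_diff_conv add.commute)
    then have p1: "?p \<in> carrier ?P" by simp
    have p2: "\<psi> (W ?p) = \<psi> c"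
      unfolding \<psi>_eq
    proof (intro allI impI)
      fix i assume i: "i < n"
      consider "i < k0" | "k0 \<le> i" "i < k1" | "k1 \<le> i" using k01 by linarith
      then show "int (D i) dvd W ?p i - c i"
      proof cases
        case 1
        then show ?thesis using lt0 by simp
      next
        case 2
        then have "W ?p i = c i mod int (D i)" by (simp add: W_def)
        then show ?thesis by (simp add: mod_eq_dvd_iff[symmetric])
      next
        case 3
        then have "i - k1 < m" using i by (auto simp: m_def)
        then have "W ?p i = c i" using 3 k01 by (simp add: W_def)
        then show ?thesis by simp
      qed
    qed
    show "y \<in> (\<lambda>p. \<psi> (W p)) ` carrier ?P"
      by (rule image_eqI[OF _ p1]) (simp only: p2 c)
  qed
  have "(\<lambda>p. \<psi> (W p)) \<in> iso ?P G"
    unfolding iso_iff using hom inj surj int_vec_hom_closed[OF \<psi>] by blast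
  then have "G \<cong> ?P" by (intro group.iso_sym[OF grp] is_isoI)
  moreover have "\<forall>d\<in>set ds. 1 < d"
  proof
    fix x assume "x \<in> set ds"
    then obtain i where "k0 \<le> i" "i < k1" "x = D i" by (auto simp: ds_def)
    then show "1 < x" using lt1[of i] ge0[of i] k1n by linarith
  qed
  moreover have "sorted_wrt (dvd) ds"
    using k1n by (auto simp: sorted_wrt_iff_nth_less len nth intro!: chain)
  ultimately show ?thesis unfolding is_invariant_factors_def by blast
qed

end

section \<open>Homomorphisms vanishing on a set\<close>

text \<open>The \<open>e j\<close> are coordinates on the free part of \<open>G/\<langle>S\<rangle>\<close>, the \<open>g j\<close> lift the dual basis, and
  \<open>d\<close> annihilates the torsion of \<open>G/\<langle>S\<rangle>\<close>.\<close>

definition dual_system ::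
  "('a, 'm) monoid_scheme \<Rightarrow> 'a set \<Rightarrow> nat \<Rightarrow> nat \<Rightarrow> (nat \<Rightarrow> 'a \<Rightarrow> int) \<Rightarrow> (nat \<Rightarrow> 'a) \<Rightarrow> bool" where
  "dual_system G S d m e g \<longleftrightarrow> 0 < d \<and>
    (\<forall>j<m. e j \<in> hom G integer_group \<and> (\<forall>s\<in>S. e j s = 0) \<and> g j \<in> carrier G) \<and>
    (\<forall>i<m. \<forall>j<m. e j (g i) = (if j = i then 1 else 0)) \<and>
    (\<forall>x\<in>carrier G. (\<forall>j<m. e j x = 0) \<longrightarrow> x [^]\<^bsub>G\<^esub> d \<in> generate G S)"

section \<open>Coordinates on the free part of a quotient\<close>

context comm_group
begin

text \<open>Justifies the choice operator in \<open>invariant_factors\<close>: a presentation of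
  \<open>G\<close> followed by the projection presents the quotient.\<close>

lemma is_invariant_factors_quotient:
  assumes "finitely_generated G" "S \<subseteq> carrier G"
  shows "is_invariant_factors (G Mod generate G S) (invariant_factors (G Mod generate G S))"
proof -
  let ?N = "generate G S"
  have sub: "subgroup ?N G" by (rule generate_is_subgroup[OF assms(2)])
  interpret N: normal ?N G using sub by (simp add: normal_iff_subgroup)
  interpret Q: comm_group "G Mod ?N" by (rule abelian_FactGroup[OF sub])
  obtain n \<psi> where \<psi>: "int_vec_hom G n \<psi>" "range \<psi> = carrier G"
    using finitely_generated_int_vec_hom[OF assms(1)] .
  have "int_vec_hom (G Mod ?N) n (\<lambda>a. ?N #> \<psi> a)"
    unfolding int_vec_hom_def
  proof (intro conjI allI impI)
    show "?N #> \<psi> a \<in> carrier (G Mod ?N)" for a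
      using int_vec_hom_closed[OF \<psi>(1)] by (auto simp: carrier_FactGroup)
    show "?N #> \<psi> (\<lambda>i. a i + b i) = (?N #> \<psi> a) \<otimes>\<^bsub>G Mod ?N\<^esub> (?N #> \<psi> b)" for a b
      using int_vec_hom_closed[OF \<psi>(1)] by (simp add: int_vec_hom_add[OF \<psi>(1)] N.rcos_sum)
    show "?N #> \<psi> a = ?N #> \<psi> b" if "\<forall>i<n. a i = b i" for a b
      using int_vec_hom_cong[OF \<psi>(1), of a b] that by simp
  qed
  moreover have "range (\<lambda>a. ?N #> \<psi> a) = carrier (G Mod ?N)"
    unfolding carrier_FactGroup \<psi>(2)[symmetric] by (simp add: image_image)
  ultimately have "\<exists>ds. is_invariant_factors (G Mod ?N) ds"
    by (rule Q.invariant_factors_exist)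
  then show ?thesis unfolding invariant_factors_def by (rule someI_ex)
qed

text \<open>The coordinates of the free summand are pulled back from the quotient to
  \<open>G\<close>. All invariant factors divide the last one, so it annihilates the torsion; this
  is also the number that enters \<open>lcm_period\<close>.\<close>

lemma dual_system_exists:
  assumes "finitely_generated G" "S \<subseteq> carrier G"
  shows "\<exists>m e g. dual_system G S (max_invariant_factor (G Mod generate G S)) m e g"
proof -
  define N where "N = generate G S"
  define Q where "Q = G Mod N"
  define ds where "ds = invariant_factors Q"
  define d where "d = max_invariant_factor Q"
  have sub: "subgroup N G" unfolding N_def by (rule generate_is_subgroup[OF assms(2)])
  interpret N: normal N G using sub by (simp add: normal_iff_subgroup)
  interpret Q: comm_group Q unfolding Q_def by (rule abelian_FactGroup[OF sub])
  let ?A = "sum_group {..<length ds} (\<lambda>i. integer_mod_group (ds ! i))"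
  have ds: "is_invariant_factors Q ds"
    using is_invariant_factors_quotient[OF assms] by (simp add: ds_def Q_def N_def)
  then obtain m :: nat where "Q \<cong> ?A \<times>\<times> sum_group {..<m} (\<lambda>_. integer_group)"
    and gt: "\<And>x. x \<in> set ds \<Longrightarrow> 1 < x" and srt: "sorted_wrt (dvd) ds"
    unfolding is_invariant_factors_def by blast
  define P where "P = ?A \<times>\<times> sum_group {..<m} (\<lambda>_. integer_group)"
  have "Q \<cong> P" unfolding P_def by fact
  then obtain h where h: "h \<in> iso Q P"
    unfolding is_iso_def by blast
  have grpP: "group P" unfolding P_def by (intro DirProd_group sum_group) auto
  have hP: "h \<in> hom Q P" "inj_on h (carrier Q)" "h ` carrier Q = carrier P"
    using h by (auto simp: iso_iff)
  have d0: "0 < d"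
    using gt[OF last_in_set] by (fastforce simp: d_def max_invariant_factor_def ds_def[symmetric])
  have dvd: "ds ! i dvd d" if "i < length ds" for i
  proof -
    have "ds ! i dvd ds ! (length ds - 1)"
      using sorted_wrt_nth_less[OF srt, of i "length ds - 1"] that
      by (cases "i = length ds - 1") auto
    moreover have "ds \<noteq> []" using that by auto
    ultimately show ?thesis
      by (simp add: d_def max_invariant_factor_def ds_def[symmetric] last_conv_nth)
  qed
  define p where "p = (\<lambda>x. h (N #> x))"
  have proj: "(\<lambda>x. N #> x) \<in> hom G Q" unfolding Q_def by (rule N.r_coset_hom_Mod)
  have p: "p \<in> hom G P" unfolding p_def using proj hP(1) by (auto simp: hom_def Pi_iff)
  interpret p: group_hom G P p
    using p grpP by (simp add: group_hom_def group_hom_axioms_def is_group)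
  have psurj: "\<exists>x\<in>carrier G. p x = y" if "y \<in> carrier P" for y
    using that unfolding hP(3)[symmetric] p_def Q_def carrier_FactGroup by blast
  have cP: "carrier P = (\<Pi>\<^sub>E i\<in>{..<length ds}. carrier (integer_mod_group (ds ! i))) \<times> (\<Pi>\<^sub>E i\<in>{..<m}. UNIV)"
    by (simp add: P_def carrier_sum_group_finite)
  \<comment> \<open>The kernel of \<open>p\<close> is that of the projection, because
    \<open>h\<close> is injective.\<close>
  have pN: "p x = \<one>\<^bsub>P\<^esub> \<longleftrightarrow> x \<in> N" if x: "x \<in> carrier G" for x
  proof -
    have "\<one>\<^bsub>P\<^esub> = h \<one>\<^bsub>Q\<^esub>" using hom_one[OF hP(1) Q.is_group grpP] by simp
    then have "p x = \<one>\<^bsub>P\<^esub> \<longleftrightarrow> N #> x = N"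
      unfolding p_def
      using inj_on_eq_iff[OF hP(2), of "N #> x" "\<one>\<^bsub>Q\<^esub>"] hom_in_carrier[OF proj x] Q.one_closed
      by (simp add: Q_def)
    also have "\<dots> \<longleftrightarrow> x \<in> N" using x sub coset_join1 coset_join2 N.subset by blast
    finally show ?thesis .
  qed
  define e where "e = (\<lambda>j x. snd (p x) j)"
  have e_hom: "e j \<in> hom G integer_group" if "j < m" for j
    using that by (intro homI) (auto simp: e_def P_def mult_DirProd')
  have e_S: "e j s = 0" if "j < m" "s \<in> S" for j s
  proof -
    have "s \<in> N" unfolding N_def using that by (rule_tac generate.incl)
    then have "p s = \<one>\<^bsub>P\<^esub>" using pN assms(2) that by blast
    then show ?thesis using that by (simp add: e_def P_def)
  qed
  have "\<forall>j. \<exists>x\<in>carrier G. p x = (fst \<one>\<^bsub>P\<^esub>, \<lambda>i\<in>{..<m}. if i = j then 1 else 0)"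
  proof
    fix j
    have "\<one>\<^bsub>P\<^esub> \<in> carrier P" by simp
    then have "(fst \<one>\<^bsub>P\<^esub>, \<lambda>i\<in>{..<m}. if i = j then 1 else 0) \<in> carrier P"
      unfolding cP by auto
    then show "\<exists>x\<in>carrier G. p x = (fst \<one>\<^bsub>P\<^esub>, \<lambda>i\<in>{..<m}. if i = j then 1 else 0)" by (rule psurj)
  qed
  then obtain g where g: "\<And>j. g j \<in> carrier G"
    "\<And>j. p (g j) = (fst \<one>\<^bsub>P\<^esub>, \<lambda>i\<in>{..<m}. if i = j then 1 else 0)" by metis
  \<comment> \<open>With vanishing free coordinates only the finite cyclic components remain, and
    each of their orders divides \<open>d\<close>.\<close>
  have tors: "x [^] d \<in> N" if x: "x \<in> carrier G" and e0: "\<And>j. j < m \<Longrightarrow> e j x = 0" for x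
  proof -
    have pw: "fst (p (x [^] k)) i = (int k * fst (p x) i) mod int (ds ! i)"
      if i: "i < length ds" for i k
    proof (induction k)
      case 0
      then show ?case using i by (simp add: P_def)
    next
      case (Suc k)
      have "p (x [^] Suc k) = p (x [^] k) \<otimes>\<^bsub>P\<^esub> p x" using x by simp
      then show ?case using Suc i e0
        by (simp add: P_def mult_DirProd' e_def mod_add_right_eq distrib_right add.commute)
    qed
    have pw2: "snd (p (x [^] k)) j = 0" if j: "j < m" for j and k :: nat
    proof (induction k)
      case 0
      then show ?case using j by (simp add: P_def)
    next
      case (Suc k)
      have "p (x [^] Suc k) = p (x [^] k) \<otimes>\<^bsub>P\<^esub> p x" using x by simp
      then show ?case using Suc j e0 by (simp add: P_def mult_DirProd' e_def)
    qed
    have "p (x [^] d) \<in> carrier P" "\<one>\<^bsub>P\<^esub> \<in> carrier P" using x by auto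
    note c = this[unfolded cP mem_Times_iff]
    have "p (x [^] d) = \<one>\<^bsub>P\<^esub>"
    proof (rule prod_eqI)
      show "fst (p (x [^] d)) = fst \<one>\<^bsub>P\<^esub>"
      proof (rule PiE_ext[OF conjunct1[OF c(1)] conjunct1[OF c(2)]])
        fix i assume "i \<in> {..<length ds}"
        then have i: "i < length ds" by simp
        have "int (ds ! i) dvd int d * fst (p x) i" using dvd[OF i] by simp
        then show "fst (p (x [^] d)) i = fst \<one>\<^bsub>P\<^esub> i" using pw[OF i] i by (simp add: P_def)
      qed
      show "snd (p (x [^] d)) = snd \<one>\<^bsub>P\<^esub>"
      proof (rule PiE_ext[OF conjunct2[OF c(1)] conjunct2[OF c(2)]])
        fix i assume "i \<in> {..<m}"
        then show "snd (p (x [^] d)) i = snd \<one>\<^bsub>P\<^esub> i" using pw2 by (simp add: P_def)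
      qed
    qed
    then show ?thesis using pN x by simp
  qed
  have "dual_system G S d m e g"
    unfolding dual_system_def
    using d0 e_hom e_S g tors by (auto simp: e_def N_def)
  then show ?thesis unfolding d_def Q_def N_def by blast
qed

end

section \<open>Finite products and the additive group of the reals\<close>

lemma group_hom_finprod:
  assumes "comm_group G" "comm_group H" "\<phi> \<in> hom G H" "f \<in> A \<rightarrow> carrier G"
  shows "\<phi> (finprod G f A) = finprod H (\<lambda>j. \<phi> (f j)) A"
proof -
  interpret G: comm_group G by fact
  interpret H: comm_group H by fact
  interpret \<phi>: group_hom G H \<phi>
    using assms(3) by (simp add: group_hom_def group_hom_axioms_def G.is_group H.is_group)
  show ?thesis
    using assms(4)
  proof (induction A rule: infinite_finite_induct)
    case (insert a A)
    then have "f a \<in> carrier G" "f \<in> A \<rightarrow> carrier G" by auto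
    moreover from this have "(\<lambda>j. \<phi> (f j)) \<in> A \<rightarrow> carrier H" "\<phi> (f a) \<in> carrier H"
      by (auto simp: Pi_iff)
    ultimately show ?case using insert by simp
  qed simp_all
qed

lemma comm_group_real_group: "comm_group real_group"
proof (rule comm_groupI)
  show "\<exists>y\<in>carrier real_group. y \<otimes>\<^bsub>real_group\<^esub> x = \<one>\<^bsub>real_group\<^esub>" for x
    by (rule bexI[of _ "- x"]) (auto simp: real_group_def)
qed (auto simp: real_group_def)

lemma real_group_simps [simp]:
  "carrier real_group = UNIV" "x \<otimes>\<^bsub>real_group\<^esub> y = x + y" "\<one>\<^bsub>real_group\<^esub> = 0"
  by (auto simp: real_group_def)

lemma real_group_pow [simp]: "x [^]\<^bsub>real_group\<^esub> (n::nat) = real n * x"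
  by (induction n) (auto simp: algebra_simps nat_pow_def)

lemma real_group_int_pow [simp]: "x [^]\<^bsub>real_group\<^esub> (k::int) = real_of_int k * x"
proof -
  interpret comm_group real_group by (rule comm_group_real_group)
  have "inv\<^bsub>real_group\<^esub> y = - y" for y by (rule inv_equality) auto
  then show ?thesis
    by (cases k rule: int_cases2) (auto simp: int_pow_neg int_pow_int)
qed

lemma finprod_real_group:
  assumes "finite A"
  shows "finprod real_group f A = sum f A"
proof -
  interpret comm_group real_group by (rule comm_group_real_group)
  show ?thesis using assms by (induction A rule: finite_induct) auto
qed

lemma sum_fun_apply: "(\<Sum>i\<in>A. f i) x = (\<Sum>i\<in>A. f i x)"
  for f :: "'i \<Rightarrow> 'a \<Rightarrow> 'b::comm_monoid_add"
  by (induction A rule: infinite_finite_induct) auto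

section \<open>Homomorphisms in terms of a dual system\<close>

locale dual_coordinates = comm_group G for G (structure) +
  fixes S :: "'a set" and d m :: nat and e :: "nat \<Rightarrow> 'a \<Rightarrow> int" and g :: "nat \<Rightarrow> 'a"
  assumes dual: "dual_system G S d m e g" and S_sub: "S \<subseteq> carrier G"
begin

lemma e_hom: "j < m \<Longrightarrow> e j \<in> hom G integer_group"
  and e_S: "j < m \<Longrightarrow> s \<in> S \<Longrightarrow> e j s = 0"
  and g_closed: "j < m \<Longrightarrow> g j \<in> carrier G"
  and e_g: "i < m \<Longrightarrow> j < m \<Longrightarrow> e j (g i) = (if j = i then 1 else 0)"
  and e_ker: "x \<in> carrier G \<Longrightarrow> (\<And>j. j < m \<Longrightarrow> e j x = 0) \<Longrightarrow> x [^] d \<in> generate G S"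
  and d_pos: "0 < d"
  using dual unfolding dual_system_def by auto

lemma e_mult: "j < m \<Longrightarrow> x \<in> carrier G \<Longrightarrow> y \<in> carrier G \<Longrightarrow> e j (x \<otimes> y) = e j x + e j y"
  using hom_mult[OF e_hom] by simp

text \<open>Dividing \<open>x\<close> by the product of the \<open>g j [^] e j x\<close> leaves an
  element \<open>y\<close> with zero coordinates, so \<open>y [^] d\<close> lies in
  \<open>generate G S\<close> and is killed by \<open>\<phi>\<close>. As \<open>H\<close> has no
  \<open>d\<close>-torsion, \<open>\<phi>\<close> kills \<open>y\<close> itself.\<close>

lemma hom_eq_finprod:
  assumes "comm_group H" "\<And>y. y \<in> carrier H \<Longrightarrow> y [^]\<^bsub>H\<^esub> d = \<one>\<^bsub>H\<^esub> \<Longrightarrow> y = \<one>\<^bsub>H\<^esub>"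
    and \<phi>: "\<phi> \<in> hom G H" "\<And>s. s \<in> S \<Longrightarrow> \<phi> s = \<one>\<^bsub>H\<^esub>" and x: "x \<in> carrier G"
  shows "\<phi> x = finprod H (\<lambda>j. \<phi> (g j) [^]\<^bsub>H\<^esub> e j x) {..<m}"
proof -
  interpret H: comm_group H by fact
  interpret \<phi>: group_hom G H \<phi>
    using \<phi>(1) by (simp add: group_hom_def group_hom_axioms_def is_group H.is_group)
  interpret Z: comm_group integer_group by (rule abelian_integer_group)
  define z where "z = finprod G (\<lambda>j. g j [^] e j x) {..<m}"
  have gP: "(\<lambda>j. g j [^] e j x) \<in> {..<m} \<rightarrow> carrier G" using g_closed by auto
  then have z: "z \<in> carrier G" unfolding z_def by (rule finprod_closed)
  have ez: "e i z = e i x" if i: "i < m" for i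
  proof -
    have "e i z = finprod integer_group (\<lambda>j. e i (g j [^] e j x)) {..<m}"
      unfolding z_def
      by (rule group_hom_finprod[OF comm_group_axioms abelian_integer_group e_hom[OF i] gP])
    also have "\<dots> = finprod integer_group (\<lambda>j. if i = j then e j x else \<one>\<^bsub>integer_group\<^esub>) {..<m}"
      using hom_int_pow[OF e_hom[OF i]] i
      by (intro Z.finprod_cong') (auto simp: g_closed e_g is_group)
    also have "\<dots> = e i x" using i by (subst Z.finprod_singleton) auto
    finally show ?thesis .
  qed
  define y where "y = x \<otimes> inv z"
  have y: "y \<in> carrier G" and xyz: "x = y \<otimes> z" using x z by (auto simp: y_def m_assoc)
  have "y [^] d \<in> generate G S"
    using e_mult[OF _ y z] ez xyz by (intro e_ker[OF y]) fastforce
  moreover have "\<phi> w = \<one>\<^bsub>H\<^esub>" if "w \<in> generate G S" for w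
    using that
  proof induction
    case (eng h1 h2)
    then show ?case using generate_in_carrier[OF S_sub] by simp
  next
    case (inv h)
    then show ?case using \<phi>(2) S_sub by auto
  qed (use \<phi>(2) in auto)
  ultimately have "\<phi> y [^]\<^bsub>H\<^esub> d = \<one>\<^bsub>H\<^esub>" using y by (simp flip: \<phi>.hom_nat_pow)
  then have "\<phi> y = \<one>\<^bsub>H\<^esub>" using assms(2) y by simp
  then have "\<phi> x = \<phi> z" using y z by (simp add: xyz)
  also have "\<dots> = finprod H (\<lambda>j. \<phi> (g j [^] e j x)) {..<m}"
    unfolding z_def by (rule group_hom_finprod[OF comm_group_axioms assms(1) \<phi>(1) gP])
  also have "\<dots> = finprod H (\<lambda>j. \<phi> (g j) [^]\<^bsub>H\<^esub> e j x) {..<m}"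
    by (rule H.finprod_cong') (auto simp: g_closed \<phi>.hom_int_pow)
  finally show ?thesis .
qed

text \<open>By \<open>hom_eq_finprod\<close> the values on the \<open>g j\<close> determine the
  homomorphism; conversely the same product formula extends arbitrary values, as the
  \<open>e j\<close> are additive, vanish on \<open>S\<close> and are dual to the
  \<open>g j\<close>.\<close>

lemma bij_betw_Hom_vanishing:
  assumes H: "comm_group H" "\<And>y. y \<in> carrier H \<Longrightarrow> y [^]\<^bsub>H\<^esub> d = \<one>\<^bsub>H\<^esub> \<Longrightarrow> y = \<one>\<^bsub>H\<^esub>"
  shows "bij_betw (\<lambda>\<phi>. \<lambda>j\<in>{..<m}. \<phi> (g j)) {\<phi> \<in> Hom G H. \<forall>s\<in>S. \<phi> s = \<one>\<^bsub>H\<^esub>}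
      ({..<m} \<rightarrow>\<^sub>E carrier H)"
proof -
  interpret H: comm_group H by fact
  \<comment> \<open>The value off the carrier is the normalisation built into \<open>Hom\<close>;
    without it \<open>ext\<close> would not be a two-sided inverse.\<close>
  define ext where "ext = (\<lambda>c x. if x \<in> carrier G then finprod H (\<lambda>j. c j [^]\<^bsub>H\<^esub> e j x) {..<m} else \<one>\<^bsub>H\<^esub>)"
  have closed: "(\<lambda>j. c j [^]\<^bsub>H\<^esub> e j x) \<in> {..<m} \<rightarrow> carrier H" if "c \<in> {..<m} \<rightarrow>\<^sub>E carrier H" for c x
    using that by auto
  show ?thesis
  proof (rule bij_betw_byWitness[where f' = ext])
    show "\<forall>\<phi>\<in>{\<phi> \<in> Hom G H. \<forall>s\<in>S. \<phi> s = \<one>\<^bsub>H\<^esub>}. ext (\<lambda>j\<in>{..<m}. \<phi> (g j)) = \<phi>"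
    proof
      fix \<phi> assume "\<phi> \<in> {\<phi> \<in> Hom G H. \<forall>s\<in>S. \<phi> s = \<one>\<^bsub>H\<^esub>}"
      then have \<phi>: "\<phi> \<in> hom G H" "\<And>s. s \<in> S \<Longrightarrow> \<phi> s = \<one>\<^bsub>H\<^esub>" "\<And>x. x \<notin> carrier G \<Longrightarrow> \<phi> x = \<one>\<^bsub>H\<^esub>"
        by (auto simp: Hom_def)
      show "ext (\<lambda>j\<in>{..<m}. \<phi> (g j)) = \<phi>"
      proof
        fix x
        have "finprod H (\<lambda>j. (\<lambda>j\<in>{..<m}. \<phi> (g j)) j [^]\<^bsub>H\<^esub> e j x) {..<m} = \<phi> x" if x: "x \<in> carrier G"
          by (subst hom_eq_finprod[OF H \<phi>(1,2) x], assumption+, rule H.finprod_cong') (use hom_in_carrier[OF \<phi>(1)] g_closed in auto)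
        then show "ext (\<lambda>j\<in>{..<m}. \<phi> (g j)) x = \<phi> x" using \<phi>(3) by (simp add: ext_def)
      qed
    qed
    show "\<forall>c\<in>{..<m} \<rightarrow>\<^sub>E carrier H. (\<lambda>j\<in>{..<m}. ext c (g j)) = c"
    proof
      fix c assume c: "c \<in> {..<m} \<rightarrow>\<^sub>E carrier H"
      have cj: "c j \<in> carrier H" if "j < m" for j using c that by auto
      have "ext c (g i) = c i" if i: "i < m" for i
      proof -
        have "ext c (g i) = finprod H (\<lambda>j. if i = j then c j else \<one>\<^bsub>H\<^esub>) {..<m}"
          unfolding ext_def using g_closed[OF i] cj
          by (auto intro!: H.finprod_cong' simp: e_g i)
        also have "\<dots> = c i"
          using cj i by (intro H.finprod_singleton) auto
        finally show ?thesis .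
      qed
      then show "(\<lambda>j\<in>{..<m}. ext c (g j)) = c"
        using c by (intro extensionalityI[of _ "{..<m}"]) (auto simp: PiE_iff)
    qed
    show "(\<lambda>\<phi>. \<lambda>j\<in>{..<m}. \<phi> (g j)) ` {\<phi> \<in> Hom G H. \<forall>s\<in>S. \<phi> s = \<one>\<^bsub>H\<^esub>} \<subseteq> {..<m} \<rightarrow>\<^sub>E carrier H"
    proof (rule image_subsetI)
      fix \<phi> assume "\<phi> \<in> {\<phi> \<in> Hom G H. \<forall>s\<in>S. \<phi> s = \<one>\<^bsub>H\<^esub>}"
      then have "\<phi> \<in> hom G H" by (simp add: Hom_def)
      then show "(\<lambda>j\<in>{..<m}. \<phi> (g j)) \<in> {..<m} \<rightarrow>\<^sub>E carrier H"
        using g_closed hom_in_carrier[of \<phi> G H] by (simp add: restrict_PiE_iff)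
    qed
    show "ext ` ({..<m} \<rightarrow>\<^sub>E carrier H) \<subseteq> {\<phi> \<in> Hom G H. \<forall>s\<in>S. \<phi> s = \<one>\<^bsub>H\<^esub>}"
    proof
      fix \<phi> assume "\<phi> \<in> ext ` ({..<m} \<rightarrow>\<^sub>E carrier H)"
      then obtain c where c: "c \<in> {..<m} \<rightarrow>\<^sub>E carrier H" and \<phi>: "\<phi> = ext c" by blast
      have cj: "c j \<in> carrier H" if "j < m" for j using c that by auto
      have "\<phi> \<in> hom G H"
      proof (rule homI)
        show "\<phi> x \<in> carrier H" if "x \<in> carrier G" for x
          unfolding \<phi> ext_def using H.finprod_closed[OF closed[OF c]] by simp
        fix x y assume xy: "x \<in> carrier G" "y \<in> carrier G"
        have "finprod H (\<lambda>j. c j [^]\<^bsub>H\<^esub> e j (x \<otimes> y)) {..<m}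
          = finprod H (\<lambda>j. c j [^]\<^bsub>H\<^esub> e j x \<otimes>\<^bsub>H\<^esub> c j [^]\<^bsub>H\<^esub> e j y) {..<m}"
          using xy by (intro H.finprod_cong') (auto simp: e_mult cj H.int_pow_mult)
        also have "\<dots> = finprod H (\<lambda>j. c j [^]\<^bsub>H\<^esub> e j x) {..<m} \<otimes>\<^bsub>H\<^esub> finprod H (\<lambda>j. c j [^]\<^bsub>H\<^esub> e j y) {..<m}"
          by (rule H.finprod_multf[OF closed[OF c] closed[OF c]])
        finally show "\<phi> (x \<otimes> y) = \<phi> x \<otimes>\<^bsub>H\<^esub> \<phi> y" using xy by (simp add: \<phi> ext_def)
      qed
      moreover have "\<phi> s = \<one>\<^bsub>H\<^esub>" if s: "s \<in> S" for s
      proof -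
        have "finprod H (\<lambda>j. c j [^]\<^bsub>H\<^esub> e j s) {..<m} = \<one>\<^bsub>H\<^esub>"
          by (rule H.finprod_one_eqI) (simp add: e_S s)
        then show ?thesis using s S_sub by (auto simp: \<phi> ext_def)
      qed
      ultimately show "\<phi> \<in> {\<phi> \<in> Hom G H. \<forall>s\<in>S. \<phi> s = \<one>\<^bsub>H\<^esub>}"
        by (simp add: Hom_def \<phi> ext_def)
    qed
  qed
qed

text \<open>Coprimality makes multiplication by \<open>d\<close> injective on the integers modulo
  \<open>q\<close>, so \<open>bij_betw_Hom_vanishing\<close> applies.\<close>

lemma card_Hom_integer_mod_group:
  assumes q: "0 < q" "coprime q d"
  shows "finite {\<phi> \<in> Hom G (integer_mod_group q). \<forall>s\<in>S. \<phi> s = 0}"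
    and "card {\<phi> \<in> Hom G (integer_mod_group q). \<forall>s\<in>S. \<phi> s = 0} = q ^ m"
proof -
  have "y = \<one>\<^bsub>integer_mod_group q\<^esub>"
    if y: "y \<in> carrier (integer_mod_group q)" "y [^]\<^bsub>integer_mod_group q\<^esub> d = \<one>\<^bsub>integer_mod_group q\<^esub>" for y
  proof -
    have "int q dvd int d * y" using y by auto
    then have "int q dvd y" using q(2) by (simp add: coprime_dvd_mult_right_iff)
    moreover have "0 \<le> y" "y < int q" using y(1) q by (auto simp: carrier_integer_mod_group)
    ultimately show ?thesis using zdvd_imp_le by fastforce
  qed
  note b = bij_betw_Hom_vanishing[OF abelian_integer_mod_group this, simplified]
  have "finite ({..<m} \<rightarrow>\<^sub>E carrier (integer_mod_group q))"
    using q by (intro finite_PiE) (auto simp: carrier_integer_mod_group)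
  then show "finite {\<phi> \<in> Hom G (integer_mod_group q). \<forall>s\<in>S. \<phi> s = 0}"
    using bij_betw_finite[OF b] by simp
  show "card {\<phi> \<in> Hom G (integer_mod_group q). \<forall>s\<in>S. \<phi> s = 0} = q ^ m"
    using bij_betw_same_card[OF b] q by (simp add: card_PiE carrier_integer_mod_group)
qed

definition real_coordinate :: "nat \<Rightarrow> 'a \<Rightarrow> real" where
  "real_coordinate j x = (if x \<in> carrier G then real_of_int (e j x) else 0)"

lemma real_coordinate_Hom:
  assumes "j < m"
  shows "real_coordinate j \<in> Hom G real_group"
  using assms by (auto simp: Hom_def hom_def real_coordinate_def e_mult)

text \<open>The real coordinates form a basis: they span by \<open>hom_eq_finprod\<close>, the reals
  being torsion-free, and evaluation at the \<open>g i\<close> shows independence. The dimension is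
  thus the exponent \<open>m\<close> of the count modulo \<open>q\<close>.\<close>

lemma fun_dim_Hom_real:
  "fun_dim {\<phi> \<in> Hom G real_group. \<forall>s\<in>S. \<phi> s = 0} = m"
proof -
  interpret R: vector_space "fun_scale :: real \<Rightarrow> ('a \<Rightarrow> real) \<Rightarrow> 'a \<Rightarrow> real"
    by (rule vector_space_fun_scale)
  let ?b = real_coordinate
  have bg: "?b j (g i) = (if j = i then 1 else 0)" if "i < m" "j < m" for i j
    using that by (simp add: real_coordinate_def g_closed e_g)
  have inj: "inj_on ?b {..<m}"
  proof (rule inj_onI)
    fix i j assume ij: "i \<in> {..<m}" "j \<in> {..<m}" and eq: "?b i = ?b j"
    from ij have "?b i (g i) = 1" "?b j (g i) = (if j = i then 1 else 0)" by (simp_all add: bg)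
    then show "i = j" unfolding eq by (simp split: if_splits)
  qed
  show ?thesis
    unfolding fun_dim_def
  proof (rule R.dim_unique[where B = "?b ` {..<m}"])
    show "?b ` {..<m} \<subseteq> {\<phi> \<in> Hom G real_group. \<forall>s\<in>S. \<phi> s = 0}"
      using real_coordinate_Hom by (auto simp: real_coordinate_def e_S)
    show "{\<phi> \<in> Hom G real_group. \<forall>s\<in>S. \<phi> s = 0} \<subseteq> R.span (?b ` {..<m})"
    proof
      fix \<phi> assume "\<phi> \<in> {\<phi> \<in> Hom G real_group. \<forall>s\<in>S. \<phi> s = 0}"
      then have \<phi>: "\<phi> \<in> hom G real_group" "\<And>s. s \<in> S \<Longrightarrow> \<phi> s = \<one>\<^bsub>real_group\<^esub>" "\<And>x. x \<notin> carrier G \<Longrightarrow> \<phi> x = 0"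
        by (auto simp: Hom_def)
      have tf: "y = \<one>\<^bsub>real_group\<^esub>" if "y [^]\<^bsub>real_group\<^esub> d = \<one>\<^bsub>real_group\<^esub>" for y
        using that d_pos by simp
      have "\<phi> = (\<Sum>j<m. fun_scale (\<phi> (g j)) (?b j))"
      proof
        fix x
        show "\<phi> x = (\<Sum>j<m. fun_scale (\<phi> (g j)) (?b j)) x"
        proof (cases "x \<in> carrier G")
          case True
          show ?thesis
            unfolding sum_fun_apply using hom_eq_finprod[OF comm_group_real_group tf \<phi>(1,2) True] True
            by (simp add: finprod_real_group real_coordinate_def mult.commute)
        next
          case False
          then show ?thesis unfolding sum_fun_apply by (simp add: \<phi>(3) real_coordinate_def)
        qed
      qed
      moreover have "(\<Sum>j<m. fun_scale (\<phi> (g j)) (?b j)) \<in> R.span (?b ` {..<m})"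
        by (intro R.span_sum R.span_scale R.span_base) auto
      ultimately show "\<phi> \<in> R.span (?b ` {..<m})" by simp
    qed
    show "R.independent (?b ` {..<m})"
    proof (rule R.independent_if_scalars_zero)
      fix f x assume s: "(\<Sum>x\<in>?b ` {..<m}. fun_scale (f x) x) = 0" and "x \<in> ?b ` {..<m}"
      then obtain i where i: "i < m" "x = ?b i" by blast
      have "0 = (\<Sum>x\<in>?b ` {..<m}. fun_scale (f x) x) (g i)" using s by simp
      also have "\<dots> = (\<Sum>j<m. f (?b j) * ?b j (g i))"
        unfolding sum_fun_apply by (subst sum.reindex[OF inj]) simp
      also have "\<dots> = (\<Sum>j<m. if j = i then f (?b i) else 0)"
        using i by (intro sum.cong) (auto simp: bg)
      also have "\<dots> = f x" using i by simp
      finally show "f x = 0" by simp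
    qed simp
    show "card (?b ` {..<m}) = m" by (simp add: card_image[OF inj])
  qed
qed

end

section \<open>Whitney's theorem and inclusion-exclusion\<close>

text \<open>The sum is the expansion of the product of the factors \<open>-1 + 1\<close> over
  \<open>T\<close>.\<close>

lemma sum_Pow_alternating:
  assumes "finite T"
  shows "(\<Sum>S\<in>Pow T. (- 1) ^ card S) = (if T = {} then 1 else (0::int))"
  using prod_add[OF assms, of "\<lambda>_. -1 :: int" "\<lambda>_. 1"] assms by (simp add: power_0_left)

text \<open>After exchanging the sums, each \<open>\<phi>\<close> contributes the alternating sum
  over the subsets of \<open>{b \<in> B. P \<phi> b}\<close>, which is \<open>0\<close> unless that
  set is empty.\<close>

lemma card_avoiding_inclusion_exclusion:
  assumes "finite \<Phi>" "finite B"
  shows "int (card {\<phi> \<in> \<Phi>. \<forall>b\<in>B. \<not> P \<phi> b}) =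
    (\<Sum>S\<in>Pow B. (- 1) ^ card S * int (card {\<phi> \<in> \<Phi>. \<forall>b\<in>S. P \<phi> b}))"
proof -
  have "(\<Sum>S\<in>Pow B. (- 1) ^ card S * int (card {\<phi> \<in> \<Phi>. \<forall>b\<in>S. P \<phi> b}))
    = (\<Sum>S\<in>Pow B. \<Sum>\<phi>\<in>\<Phi>. if \<forall>b\<in>S. P \<phi> b then (- 1) ^ card S else 0)"
    by (intro sum.cong refl) (simp add: sum.If_cases[OF assms(1)] Int_def)
  also have "\<dots> = (\<Sum>\<phi>\<in>\<Phi>. \<Sum>S\<in>Pow B. if \<forall>b\<in>S. P \<phi> b then (- 1) ^ card S else 0)"
    by (rule sum.swap)
  also have "\<dots> = (\<Sum>\<phi>\<in>\<Phi>. if \<forall>b\<in>B. \<not> P \<phi> b then 1 else 0)"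
  proof (rule sum.cong[OF refl])
    fix \<phi>
    have "(\<Sum>S\<in>Pow B. if \<forall>b\<in>S. P \<phi> b then (- 1) ^ card S else 0)
      = (\<Sum>S\<in>{S \<in> Pow B. \<forall>b\<in>S. P \<phi> b}. (- 1) ^ card S :: int)"
      using assms(2) by (intro sum.inter_filter[symmetric]) simp
    also have "{S \<in> Pow B. \<forall>b\<in>S. P \<phi> b} = Pow {b \<in> B. P \<phi> b}" by auto
    also have "(\<Sum>S\<in>\<dots>. (- 1) ^ card S :: int) = (if {b \<in> B. P \<phi> b} = {} then 1 else 0)"
      using assms(2) by (intro sum_Pow_alternating) simp
    also have "\<dots> = (if \<forall>b\<in>B. \<not> P \<phi> b then 1 else 0)" by auto
    finally show "(\<Sum>S\<in>Pow B. if \<forall>b\<in>S. P \<phi> b then (- 1) ^ card S else 0)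
      = (if \<forall>b\<in>B. \<not> P \<phi> b then 1 else (0::int))" .
  qed
  also have "\<dots> = int (card {\<phi> \<in> \<Phi>. \<forall>b\<in>B. \<not> P \<phi> b})"
    by (simp add: sum.If_cases[OF assms(1)] Int_def)
  finally show ?thesis by simp
qed

text \<open>The right-hand side satisfies the recursion of the Moebius function: summed over all
  \<open>Z\<close> in \<open>L\<close> containing \<open>Y\<close>, it gives \<open>1\<close> for
  \<open>Y = V\<close> and \<open>0\<close> otherwise.\<close>

lemma moebius_rev_Whitney:
  fixes F :: "'b \<Rightarrow> 'v set"
  assumes B: "finite B" and F: "\<And>b. b \<in> B \<Longrightarrow> F b \<subset> V"
  defines "X \<equiv> \<lambda>S. V \<inter> \<Inter>(F ` S)"
  defines "L \<equiv> X ` Pow B"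
  assumes "Y \<in> L"
  shows "moebius_rev L V Y = (\<Sum>S\<in>{S \<in> Pow B. X S = Y}. (- 1) ^ card S)"
  using \<open>Y \<in> L\<close>
proof (induction "card {Z \<in> L. Y \<subset> Z}" arbitrary: Y rule: less_induct)
  case less
  define h where "h = (\<lambda>Y. \<Sum>S\<in>{S \<in> Pow B. X S = Y}. (- 1) ^ card S :: int)"
  have finL: "finite L" using B by (simp add: L_def)
  have XV: "X S \<subseteq> V" for S by (auto simp: X_def)
  have YV: "Y \<subseteq> V" using less.prems XV by (auto simp: L_def)
  \<comment> \<open>Grouping by \<open>X S = Z\<close> turns this into one alternating sum over the
    subsets of \<open>{b \<in> B. Y \<subseteq> F b}\<close>.\<close>
  have "(\<Sum>Z\<in>{Z \<in> L. Y \<subseteq> Z}. h Z)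
    = (\<Sum>Z\<in>{Z \<in> L. Y \<subseteq> Z}. \<Sum>S\<in>{S \<in> {S \<in> Pow B. Y \<subseteq> X S}. X S = Z}. (- 1) ^ card S)"
    unfolding h_def by (intro sum.cong) auto
  also have "\<dots> = (\<Sum>S\<in>{S \<in> Pow B. Y \<subseteq> X S}. (- 1) ^ card S)"
    by (rule sum.group) (use B finL in \<open>auto simp: L_def\<close>)
  also have "{S \<in> Pow B. Y \<subseteq> X S} = Pow {b \<in> B. Y \<subseteq> F b}"
    using YV by (auto simp: X_def)
  also have "(\<Sum>S\<in>\<dots>. (- 1) ^ card S :: int) = (if {b \<in> B. Y \<subseteq> F b} = {} then 1 else 0)"
    using B by (intro sum_Pow_alternating) simp
  \<comment> \<open>The direction from right to left is where properness of the \<open>F b\<close>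
    enters.\<close>
  also have "{b \<in> B. Y \<subseteq> F b} = {} \<longleftrightarrow> Y = V"
  proof
    assume e: "{b \<in> B. Y \<subseteq> F b} = {}"
    obtain S where S: "S \<subseteq> B" "Y = X S" using less.prems by (auto simp: L_def)
    then have "S = {}" using e by (auto simp: X_def)
    then show "Y = V" using S by (simp add: X_def)
  qed (use F in blast)
  finally have total: "(\<Sum>Z\<in>{Z \<in> L. Y \<subseteq> Z}. h Z) = (if Y = V then 1 else 0)" .
  have "{Z \<in> L. Y \<subseteq> Z} = insert Y {Z \<in> L. Y \<subset> Z}" using less.prems by auto
  then have split: "(\<Sum>Z\<in>{Z \<in> L. Y \<subseteq> Z}. h Z) = h Y + (\<Sum>Z\<in>{Z \<in> L. Y \<subset> Z}. h Z)"
    using finL by simp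
  have LV: "Z \<subseteq> V" if "Z \<in> L" for Z using that XV by (auto simp: L_def)
  show ?case
  proof (cases "Y = V")
    case True
    then have "{Z \<in> L. Y \<subset> Z} = {}" using LV by blast
    then have "(\<Sum>Z\<in>{Z \<in> L. Y \<subset> Z}. h Z) = 0" by (simp only: sum.empty)
    then have "h Y = 1" using total split True by simp
    then show ?thesis using True by (subst moebius_rev.simps) (simp add: h_def)
  next
    case False
    then have "moebius_rev L V Y = - (\<Sum>Z\<in>{Z \<in> L. Y \<subset> Z \<and> Z \<subseteq> V}. moebius_rev L V Z)"
      using YV finL by (subst moebius_rev.simps) auto
    also have "{Z \<in> L. Y \<subset> Z \<and> Z \<subseteq> V} = {Z \<in> L. Y \<subset> Z}" using LV by blast
    also have "(\<Sum>Z\<in>{Z \<in> L. Y \<subset> Z}. moebius_rev L V Z) = (\<Sum>Z\<in>{Z \<in> L. Y \<subset> Z}. h Z)"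
    proof (rule sum.cong[OF refl])
      fix Z assume Z: "Z \<in> {Z \<in> L. Y \<subset> Z}"
      then have "card {W \<in> L. Z \<subset> W} < card {W \<in> L. Y \<subset> W}"
        using finL by (intro psubset_card_mono) auto
      then show "moebius_rev L V Z = h Z" unfolding h_def using less.hyps Z by blast
    qed
    finally show ?thesis using total split False by (simp add: h_def)
  qed
qed

text \<open>Since \<open>dm (X S)\<close> depends only on the intersection, the sum over subsets can
  be regrouped by \<open>X S\<close>.\<close>

lemma sum_moebius_rev_Whitney:
  fixes F :: "'b \<Rightarrow> 'v set"
  assumes B: "finite B" and F: "\<And>b. b \<in> B \<Longrightarrow> F b \<subset> V"
  defines "X \<equiv> \<lambda>S. V \<inter> \<Inter>(F ` S)"
  shows "(\<Sum>Y\<in>X ` Pow B. monom (moebius_rev (X ` Pow B) V Y) (dm Y)) =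
    (\<Sum>S\<in>Pow B. monom ((- 1) ^ card S) (dm (X S)))"
proof -
  have "(\<Sum>Y\<in>X ` Pow B. monom (moebius_rev (X ` Pow B) V Y) (dm Y)) =
    (\<Sum>Y\<in>X ` Pow B. \<Sum>S\<in>{S \<in> Pow B. X S = Y}. monom ((- 1) ^ card S) (dm (X S)))"
  proof (rule sum.cong[OF refl])
    fix Y assume "Y \<in> X ` Pow B"
    then have "moebius_rev (X ` Pow B) V Y = (\<Sum>S\<in>{S \<in> Pow B. X S = Y}. (- 1) ^ card S)"
      unfolding X_def by (intro moebius_rev_Whitney B F)
    then show "monom (moebius_rev (X ` Pow B) V Y) (dm Y) =
        (\<Sum>S\<in>{S \<in> Pow B. X S = Y}. monom ((- 1) ^ card S) (dm (X S)))"
      by (simp add: monom_sum)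
  qed
  also have "\<dots> = (\<Sum>S\<in>Pow B. monom ((- 1) ^ card S) (dm (X S)))"
    by (rule sum.group) (use B in auto)
  finally show ?thesis .
qed

section \<open>Evaluation of both polynomials\<close>

context comm_group
begin

lemma hyperplane_real_torsion:
  assumes "\<alpha> \<in> torsion_subgroup G"
  shows "hyperplane_real G \<alpha> = Hom G real_group"
proof -
  obtain n :: nat where n: "0 < n" "\<alpha> [^] n = \<one>" and \<alpha>: "\<alpha> \<in> carrier G"
    using assms by (auto simp: torsion_subgroup_def)
  have "\<phi> \<alpha> = 0" if \<phi>: "\<phi> \<in> Hom G real_group" for \<phi>
  proof -
    interpret \<phi>: group_hom G real_group \<phi>
      using \<phi> comm_group_real_group
      by (simp add: group_hom_def group_hom_axioms_def Hom_def is_group comm_group.axioms(2))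
    have "real n * \<phi> \<alpha> = \<phi> (\<alpha> [^] n)" using \<phi>.hom_nat_pow[OF \<alpha>, of n] by simp
    then show ?thesis using n \<phi>.hom_one by simp
  qed
  then show ?thesis by (auto simp: hyperplane_real_def)
qed

text \<open>For a dual system of the empty set, \<open>\<alpha>\<close> has a nonzero coordinate
  \<open>e j \<alpha>\<close>, since otherwise \<open>\<alpha> [^] d\<close> would be trivial. That
  coordinate, read over the reals, lies outside the hyperplane.\<close>

lemma hyperplane_real_nontorsion:
  assumes "finitely_generated G" "\<alpha> \<in> carrier G" "\<alpha> \<notin> torsion_subgroup G"
  shows "hyperplane_real G \<alpha> \<subset> Hom G real_group"
proof -
  obtain d m e g where dual: "dual_system G {} d m e g"
    using dual_system_exists[OF assms(1), of "{}"] by blast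
  interpret dual_coordinates G "{}" d m e g by unfold_locales (use dual in auto)
  have "\<exists>j<m. e j \<alpha> \<noteq> 0"
  proof (rule ccontr)
    assume "\<not> ?thesis"
    then have "\<alpha> [^] d = \<one>" using e_ker[OF assms(2)] by (auto simp: generate_empty)
    then have "\<alpha> \<in> torsion_subgroup G"
      unfolding torsion_subgroup_def using assms(2) d_pos by blast
    then show False using assms(3) by blast
  qed
  then obtain j where "j < m" "real_coordinate j \<alpha> \<noteq> 0"
    using assms(2) by (auto simp: real_coordinate_def)
  then have "real_coordinate j \<in> Hom G real_group" "real_coordinate j \<notin> hyperplane_real G \<alpha>"
    using real_coordinate_Hom by (auto simp: hyperplane_real_def)
  then show ?thesis by (auto simp: hyperplane_real_def)
qed

lemma intersection_poset_real:
  defines "V \<equiv> Hom G real_group"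
  shows "intersection_poset V (arrangement_real G A) =
    (\<lambda>S. V \<inter> \<Inter>(hyperplane_real G ` S)) ` Pow (set (filter (\<lambda>\<alpha>. \<alpha> \<notin> torsion_subgroup G) A))"
    (is "_ = ?X ` Pow ?B")
proof (intro equalityI subsetI)
  fix Y assume "Y \<in> intersection_poset V (arrangement_real G A)"
  then obtain N where N: "N \<subseteq># arrangement_real G A" and Y: "Y = V \<inter> \<Inter>(set_mset N)"
    by (auto simp: intersection_poset_def)
  have sub: "set_mset N \<subseteq> hyperplane_real G ` set A"
    using set_mset_mono[OF N] by (simp add: arrangement_real_def)
  let ?S = "{b \<in> ?B. hyperplane_real G b \<in> set_mset N}"
  have "Y = ?X ?S"
  proof (intro equalityI subsetI)
    fix \<phi> assume \<phi>: "\<phi> \<in> ?X ?S"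
    have "\<phi> \<in> H" if H: "H \<in> set_mset N" for H
    proof -
      obtain a where a: "a \<in> set A" "H = hyperplane_real G a" using sub H by blast
      show ?thesis
      proof (cases "a \<in> torsion_subgroup G")
        case True
        then show ?thesis using hyperplane_real_torsion a \<phi> by (auto simp: V_def)
      next
        case False
        then show ?thesis using a H \<phi> by auto
      qed
    qed
    then show "\<phi> \<in> Y" using \<phi> by (auto simp: Y)
  qed (auto simp: Y)
  then show "Y \<in> ?X ` Pow ?B" by blast
next
  fix Y assume "Y \<in> ?X ` Pow ?B"
  then obtain S where S: "S \<subseteq> ?B" "Y = ?X S" by blast
  \<comment> \<open>Each hyperplane is taken once, which keeps \<open>?N\<close> within the
    multiplicities of the arrangement.\<close>
  let ?N = "mset_set (hyperplane_real G ` S)"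
  have fin: "finite (hyperplane_real G ` S)" using S(1) finite_subset[OF S(1)] by simp
  have "hyperplane_real G ` S \<subseteq> set_mset (arrangement_real G A)"
    using S(1) by (auto simp: arrangement_real_def)
  then have "?N \<subseteq># mset_set (set_mset (arrangement_real G A))"
    by (intro subset_imp_msubset_mset_set) auto
  then have "?N \<subseteq># arrangement_real G A"
    using mset_set_set_mset_msubset subset_mset.order_trans by blast
  moreover have "Y = V \<inter> \<Inter>(set_mset ?N)" using S(2) fin by simp
  ultimately show "Y \<in> intersection_poset V (arrangement_real G A)"
    unfolding intersection_poset_def by blast
qed

lemma char_poly_real_Whitney:
  assumes "finitely_generated G" "set A \<subseteq> carrier G"
  shows "char_poly_real G A = (\<Sum>S\<in>Pow (set (filter (\<lambda>\<alpha>. \<alpha> \<notin> torsion_subgroup G) A)).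
    monom ((- 1) ^ card S) (fun_dim {\<phi> \<in> Hom G real_group. \<forall>s\<in>S. \<phi> s = 0}))"
proof -
  let ?B = "set (filter (\<lambda>\<alpha>. \<alpha> \<notin> torsion_subgroup G) A)"
  let ?V = "Hom G real_group"
  have "Hom G real_group \<inter> \<Inter>(hyperplane_real G ` S) = {\<phi> \<in> Hom G real_group. \<forall>s\<in>S. \<phi> s = 0}" for S
    by (auto simp: hyperplane_real_def)
  moreover have "hyperplane_real G b \<subset> ?V" if "b \<in> ?B" for b
    using that assms by (intro hyperplane_real_nontorsion) auto
  ultimately show ?thesis
    unfolding char_poly_real_def Let_def intersection_poset_real
    by (subst sum_moebius_rev_Whitney) auto
qed

text \<open>Inclusion-exclusion reduces the count to homomorphisms vanishing on \<open>S\<close>.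
  Their number and the real dimension are read off from the same dual system, so the exponents
  agree.\<close>

lemma chromatic_quasi_eq_sum:
  assumes "finitely_generated G" "set B \<subseteq> carrier G" "0 < q" "[q = 1] (mod lcm_period G B)"
  shows "int (chromatic_quasi G B q) = (\<Sum>S\<in>Pow (set B).
    (- 1) ^ card S * int q ^ fun_dim {\<phi> \<in> Hom G real_group. \<forall>s\<in>S. \<phi> s = 0})"
proof -
  have count: "finite {\<phi> \<in> Hom G (integer_mod_group q). \<forall>s\<in>S. \<phi> s = 0} \<and>
      card {\<phi> \<in> Hom G (integer_mod_group q). \<forall>s\<in>S. \<phi> s = 0}
      = q ^ fun_dim {\<phi> \<in> Hom G real_group. \<forall>s\<in>S. \<phi> s = 0}" if S: "S \<subseteq> set B" for S
  proof -
    let ?d = "max_invariant_factor (G Mod generate G S)"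
    have SG: "S \<subseteq> carrier G" using S assms(2) by blast
    obtain m e g where dual: "dual_system G S ?d m e g"
      using dual_system_exists[OF assms(1) SG] by blast
    interpret dual_coordinates G S ?d m e g by unfold_locales (use dual SG in auto)
    \<comment> \<open>The period ranges over sublists; any subset is the set of entries of one of
      them, so \<open>?d\<close> occurs in the \<open>Lcm\<close>.\<close>
    obtain S' where "S' \<in> set (subseqs B)" "S = set S'" using subset_subseqs[OF S] by blast
    then have "?d dvd lcm_period G B" unfolding lcm_period_def by (intro dvd_Lcm) blast
    then have "[q = 1] (mod ?d)" using assms(4) cong_dvd_modulus_nat by blast
    then have "coprime q ?d" using cong_imp_coprime[of 1 q ?d] by (simp add: cong_sym)
    then show ?thesis
      using card_Hom_integer_mod_group[OF assms(3)] by (simp add: fun_dim_Hom_real)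
  qed
  have "finite (Hom G (integer_mod_group q))" using count[of "{}"] by simp
  then show ?thesis
    unfolding chromatic_quasi_def one_integer_mod_group
    by (subst card_avoiding_inclusion_exclusion) (auto intro!: sum.cong simp: count)
qed

text \<open>With period \<open>0\<close> the congruence would leave only \<open>q = 1\<close>, and
  the constituent would not be determined.\<close>

lemma lcm_period_pos:
  assumes "finitely_generated G" "set B \<subseteq> carrier G"
  shows "0 < lcm_period G B"
proof -
  have "0 < max_invariant_factor (G Mod generate G (set S))" if "S \<in> set (subseqs B)" for S
  proof -
    have "set S \<subseteq> carrier G" using that assms(2) subseqs_powset[of B] by blast
    then show ?thesis using dual_system_exists[OF assms(1)] unfolding dual_system_def by blast
  qed
  then have "0 \<notin> (\<lambda>S. max_invariant_factor (G Mod generate G (set S))) ` set (subseqs B)"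
    by fastforce
  then show ?thesis unfolding lcm_period_def by (auto simp: Lcm_0_iff intro: gr0I)
qed

text \<open>Uniqueness for the definite description: two candidates agree at the infinitely many
  integers \<open>1 + k * lcm_period G B\<close>, so their difference has infinitely many
  roots.\<close>

lemma first_constituent_eqI:
  assumes "finitely_generated G" "set B \<subseteq> carrier G"
    and f: "\<And>q. 0 < q \<Longrightarrow> [q = 1] (mod lcm_period G B) \<Longrightarrow>
      int (chromatic_quasi G B q) = poly f (int q)"
  shows "first_constituent G B = f"
  unfolding first_constituent_def
proof (rule the_equality)
  fix f' assume f': "\<forall>q>0. [q = 1] (mod lcm_period G B) \<longrightarrow> int (chromatic_quasi G B q) = poly f' (int q)"
  let ?Q = "(\<lambda>k. int (1 + k * lcm_period G B)) ` UNIV"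
  have "poly (f' - f) x = 0" if Q: "x \<in> ?Q" for x
  proof -
    obtain k q where x: "x = int q" and q: "q = 1 + k * lcm_period G B" using Q by blast
    have "[q = 1] (mod lcm_period G B)"
      unfolding cong_def q by (rule mod_mult_self1)
    moreover have "0 < q" by (simp add: q)
    ultimately have "poly f' (int q) = poly f (int q)" using f f' by metis
    then show ?thesis by (simp add: x)
  qed
  then have "?Q \<subseteq> {x. poly (f' - f) x = 0}" by blast
  moreover have "infinite ?Q"
    by (rule range_inj_infinite) (use lcm_period_pos[OF assms(1,2)] in \<open>auto simp: inj_on_def\<close>)
  ultimately have "f' - f = 0" using poly_roots_finite finite_subset by blast
  then show "f' = f" by simp
qed (use f in blast)

end

theorem theorem4p4:
  fixes \<Gamma> :: "('a, 'm) monoid_scheme" and \<A> :: "'a list"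
  assumes "comm_group \<Gamma>" and "finitely_generated \<Gamma>" and "set \<A> \<subseteq> carrier \<Gamma>"
  shows "char_poly_real \<Gamma> \<A> =
    first_constituent \<Gamma> (filter (\<lambda>\<alpha>. \<alpha> \<notin> torsion_subgroup \<Gamma>) \<A>)"
proof -
  interpret comm_group \<Gamma> by fact
  let ?B = "filter (\<lambda>\<alpha>. \<alpha> \<notin> torsion_subgroup \<Gamma>) \<A>"
  have B: "set ?B \<subseteq> carrier \<Gamma>" using assms(3) by auto
  \<comment> \<open>It suffices that the characteristic polynomial has the values required of the
    constituent; both are the same sum over subsets of \<open>set ?B\<close>.\<close>
  have "first_constituent \<Gamma> ?B = char_poly_real \<Gamma> \<A>"
  proof (rule first_constituent_eqI[OF assms(2) B])
    fix q :: nat assume "0 < q" "[q = 1] (mod lcm_period \<Gamma> ?B)"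
    from chromatic_quasi_eq_sum[OF assms(2) B this]
    show "int (chromatic_quasi \<Gamma> ?B q) = poly (char_poly_real \<Gamma> \<A>) (int q)"
      unfolding char_poly_real_Whitney[OF assms(2,3)] by (simp add: poly_sum poly_monom)
  qed
  then show ?thesis by simp
qed

end
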